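(* Let $p$ be a prime number and let $F$ be an extension field of $\mathbb{Z}_p$ of finite vector space dimension $n$, where $n = mp$ for some positive integer $m$. Let $\alpha \in F\setminus\{0\}$ be such that the polynomial $x^{p}-x-\alpha$ is irreducible in $F[x]$ and the set $\{\alpha^{-p^{i}} : 0 \le i \le n-1\}$ is a basis for $F$ as an extension field of $\mathbb{Z}_p$. Let $\widehat{F} = F[\beta]/(\beta^{p}-\beta-\alpha)$, and let $\delta = (\beta^{-1}-b)^{-1}$ for some $b \in \mathbb{Z}_p\setminus\{0\}$. Then the polynomial $x^{p}-x-\delta$ is irreducible in $\widehat{F}[x]$, and the set $\{\delta^{-p^{i}} : 0 \le i \le np-1\}$ is a basis for $\widehat{F}$ as an extension field of $\mathbb{Z}_p$.
   Context: $\mathbb{Z}_p$ denotes the prime field of integers modulo $p$. In $\widehat{F} = F[\beta]/(\beta^{p}-\beta-\alpha)$, $\beta$ also denotes the residue class of the indeterminate, so $\beta \in \widehat{F}$ is a root of $x^p-x-\alpha$. "The set is a basis" means that the listed elements are pairwise distinct and form a vector space basis over the indicated field. $\delta^{-p^i}$ means $(\delta^{-1})^{p^i}$, and likewise for $\alpha$. *)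

theory Defs
  imports "HOL-Algebra.Polynomial_Divisibility" "HOL-Number_Theory.Residues"
begin

text \<open>
  The prime field \<open>\<int>\<^sub>p\<close> is \<^const>\<open>residue_ring\<close> at \<open>int p\<close>.  An extension field of \<open>\<int>\<^sub>p\<close> is a
  field \<open>F\<close> with a ring homomorphism \<open>\<iota>\<close> from \<open>\<int>\<^sub>p\<close> to \<open>F\<close> (unique if it exists, and injective);
  linear algebra over \<open>\<int>\<^sub>p\<close> then means linear algebra over the subfield
  \<open>\<iota> ` carrier (residue_ring (int p))\<close>.
\<close>

text \<open>
  Over a subfield \<open>K\<close>, independence of a list entails that its entries are distinct
  (lemma \<open>independent_distinct\<close>), so \<open>us\<close> enumerates the basis without repetition.
\<close>

definition basis_over :: "('a, 'b) ring_scheme \<Rightarrow> 'a set \<Rightarrow> 'a list \<Rightarrow> bool" where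
  "basis_over F K us \<longleftrightarrow> ring.independent F K us \<and> ring.Span F K us = carrier F"

definition inv_frobenius_list :: "('a, 'b) ring_scheme \<Rightarrow> nat \<Rightarrow> 'a \<Rightarrow> nat \<Rightarrow> 'a list" where
  "inv_frobenius_list F p a n = map (\<lambda>i. (inv\<^bsub>F\<^esub> a) [^]\<^bsub>F\<^esub> (p ^ i :: nat)) [0..<n]"

definition artin_schreier_poly :: "('a, 'b) ring_scheme \<Rightarrow> nat \<Rightarrow> 'a \<Rightarrow> 'a list" where
  "artin_schreier_poly F p a =
     X\<^bsub>F\<^esub> [^]\<^bsub>poly_ring F\<^esub> p \<ominus>\<^bsub>poly_ring F\<^esub> X\<^bsub>F\<^esub> \<ominus>\<^bsub>poly_ring F\<^esub> ring.poly_of_const F a"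

text \<open>The quotient \<open>F[X]/(X\<^sup>p - X - a)\<close>.\<close>

definition artin_schreier_ext :: "('a, 'b) ring_scheme \<Rightarrow> nat \<Rightarrow> 'a \<Rightarrow> ('a list set) ring" where
  "artin_schreier_ext F p a = Rupt\<^bsub>F\<^esub> (carrier F) (artin_schreier_poly F p a)"

text \<open>The residue class of the indeterminate.\<close>

definition artin_schreier_root :: "('a, 'b) ring_scheme \<Rightarrow> nat \<Rightarrow> 'a \<Rightarrow> 'a list set" where
  "artin_schreier_root F p a =
     ring.rupture_surj F (carrier F) (artin_schreier_poly F p a) X\<^bsub>F\<^esub>"

text \<open>The canonical embedding of \<open>F\<close>: an element is sent to the residue class of the constant.\<close>

definition artin_schreier_embed :: "('a, 'b) ring_scheme \<Rightarrow> nat \<Rightarrow> 'a \<Rightarrow> 'a \<Rightarrow> 'a list set" where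
  "artin_schreier_embed F p a c =
     ring.rupture_surj F (carrier F) (artin_schreier_poly F p a) (ring.poly_of_const F c)"

end

theory Submission
  imports Defs
begin

text \<open>
  Let \<open>|F| = p\<^sup>n\<close>, let \<open>\<sigma>\<close> be the Frobenius map of \<open>F(\<beta>)\<close>, and put \<open>\<gamma> = 1/\<delta> = 1/\<beta> - b\<close>.  From \<open>\<beta>\<^sup>p = \<beta> + \<alpha>\<close> one gets
  \<open>\<sigma>\<^sup>n \<beta> = \<beta> + t\<close> with a nonzero \<open>t\<close> fixed by \<open>\<sigma>\<close>, so \<open>\<Delta> = \<sigma>\<^sup>n - 1\<close> is \<open>F\<close>-linear and lowers the degree of
  polynomials in \<open>\<beta>\<close> by one.  Since \<open>1/\<beta> = (\<beta>\<^sup>p\<^sup>-\<^sup>1 - 1)/\<alpha>\<close>, the elements \<open>\<Delta>\<^sup>i \<gamma>\<close> have degree \<open>p - 1 - i\<close> and leading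
  coefficient \<open>1/\<alpha>\<close> up to a factor fixed by \<open>\<sigma>\<close>.  As the conjugates of \<open>1/\<alpha>\<close> span \<open>F\<close>, induction on the
  degree shows that the \<open>np\<close> conjugates of \<open>\<gamma>\<close> span \<open>F(\<beta>)\<close>, so they are a basis.

  In particular the absolute trace of \<open>\<gamma>\<close> is nonzero.  The trace vanishes on the image of \<open>\<Delta>\<close>, that is, on
  the polynomials of degree less than \<open>p - 1\<close>, and modulo these \<open>\<delta>\<close> is \<open>- \<gamma>/b\<^sup>2\<close>.  So the trace of \<open>\<delta>\<close> is nonzero as well,
  and this makes \<open>x\<^sup>p - x - \<delta>\<close> irreducible: a root \<open>y\<close> of an irreducible factor of degree \<open>d\<close> generates an
  extension in which \<open>y = \<sigma>\<^sup>n\<^sup>p\<^sup>d y = y + d Tr \<delta>\<close>, so \<open>p\<close> divides \<open>d\<close>.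
\<close>

section \<open>Fields of characteristic \<open>p\<close>\<close>

lemma (in abelian_monoid) a_interchange:
  assumes "a \<in> carrier G" "b \<in> carrier G" "c \<in> carrier G" "d \<in> carrier G"
  shows "(a \<oplus> b) \<oplus> (c \<oplus> d) = (a \<oplus> c) \<oplus> (b \<oplus> d)"
  using assms by (simp add: a_ac)

lemma (in cring) binomial_theorem:
  assumes x: "x \<in> carrier R" and y: "y \<in> carrier R"
  shows "(x \<oplus> y) [^] (n::nat) = (\<Oplus>k\<in>{..n}. [(n choose k)] \<cdot> (x [^] k \<otimes> y [^] (n - k)))"
proof (induction n)
  case 0
  show ?case using x y by simp
next
  case (Suc n)
  let ?g = "\<lambda>n k. [(n choose k)] \<cdot> (x [^] k \<otimes> y [^] (n - k))"
  \<comment> \<open>\<open>?h\<close> separates the binomial index from the exponents: multiplying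
    by \<open>x\<close> raises the exponent and keeps the coefficient, so that Pascal's rule can be
    applied to equal monomials.\<close>
  let ?h = "\<lambda>j k. [(n choose j)] \<cdot> (x [^] k \<otimes> y [^] (Suc n - k))"
  have cl [simp]: "\<And>n k. ?g n k \<in> carrier R" "\<And>j k. ?h j k \<in> carrier R"
    using x y by auto
  have "(x \<oplus> y) [^] Suc n = (\<Oplus>k\<in>{..n}. ?g n k) \<otimes> x \<oplus> (\<Oplus>k\<in>{..n}. ?g n k) \<otimes> y"
    using Suc x y by (simp add: r_distr)
  also have "(\<Oplus>k\<in>{..n}. ?g n k) \<otimes> x = (\<Oplus>k\<in>{..n}. ?h k (Suc k))"
    unfolding finsum_ldistr[OF finite_atMost x, of "?g n", simplified]
    using x y by (intro finsum_cong') (auto simp: add_pow_ldistr add_pow_rdistr m_ac)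
  also have "(\<Oplus>k\<in>{..n}. ?g n k) \<otimes> y = (\<Oplus>k\<in>{..n}. ?h k k)"
    unfolding finsum_ldistr[OF finite_atMost y, of "?g n", simplified]
    using x y by (intro finsum_cong') (auto simp: add_pow_ldistr m_assoc Suc_diff_le)
  also have "(\<Oplus>k\<in>{..n}. ?h k k) = (\<Oplus>k\<in>{..Suc n}. ?h k k)"
    using x y by (simp add: binomial_eq_0[of n "Suc n"])
  also have "\<dots> = (\<Oplus>k\<in>{..n}. ?h (Suc k) (Suc k)) \<oplus> y [^] Suc n"
    using finsum_Suc2[of "\<lambda>k. ?h k k" n] x y by (simp del: finsum_Suc nat_pow_Suc)
  also have "(\<Oplus>k\<in>{..n}. ?h k (Suc k)) \<oplus> ((\<Oplus>k\<in>{..n}. ?h (Suc k) (Suc k)) \<oplus> y [^] Suc n)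
     = (\<Oplus>k\<in>{..n}. ?h k (Suc k) \<oplus> ?h (Suc k) (Suc k)) \<oplus> y [^] Suc n"
    by (subst finsum_addf) (use x y cl in \<open>auto intro!: a_assoc[symmetric] finsum_closed simp del: nat_pow_Suc\<close>)
  also have "(\<Oplus>k\<in>{..n}. ?h k (Suc k) \<oplus> ?h (Suc k) (Suc k)) = (\<Oplus>k\<in>{..n}. ?g (Suc n) (Suc k))"
    using x y by (intro finsum_cong') (auto simp: add.nat_pow_mult simp del: nat_pow_Suc diff_Suc_Suc)
  also have "y [^] Suc n = ?g (Suc n) 0"
    using y by simp
  also have "(\<Oplus>k\<in>{..n}. ?g (Suc n) (Suc k)) \<oplus> ?g (Suc n) 0 = (\<Oplus>k\<in>{..Suc n}. ?g (Suc n) k)"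
    using cl(1) by (intro finsum_Suc2[symmetric]) blast
  finally show ?case .
qed

lemma (in ring) add_pow_closed [simp]: "x \<in> carrier R \<Longrightarrow> [(k::nat)] \<cdot> x \<in> carrier R"
  by (rule add.nat_pow_closed)

text \<open>A field has nonzero \<open>\<one>\<close>, so with \<open>p\<close> prime the equation
  \<open>[p] \<cdot> \<one> = \<zero>\<close> says that the characteristic is exactly
  \<open>p\<close>.\<close>

locale char_field = field R for R (structure) + fixes p :: nat
  assumes prime: "prime p" and char: "[p] \<cdot> \<one> = \<zero>"
begin

lemma p_pos [simp]: "0 < p" and p_gt_1: "Suc 0 < p"
  using prime by (auto simp: prime_gt_0_nat prime_gt_Suc_0_nat)

lemma add_pow_one_mult: "x \<in> carrier R \<Longrightarrow> [(k::nat)] \<cdot> x = ([k] \<cdot> \<one>) \<otimes> x"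
  using add_pow_ldistr[of \<one> x k] by simp

lemma char_dvd:
  assumes "x \<in> carrier R" "p dvd k" shows "[k] \<cdot> x = \<zero>"
proof -
  have "[p] \<cdot> x = \<zero>" using add_pow_one_mult[OF assms(1), of p] assms char by simp
  then show ?thesis using assms by (auto simp: add.nat_pow_pow[symmetric] elim!: dvdE)
qed

text \<open>If \<open>p\<close> did not divide \<open>k\<close>, the additive order of
  \<open>x\<close> would divide two coprime numbers, hence be 1.\<close>

lemma add_pow_eq_zero_iff:
  assumes x: "x \<in> carrier R" "x \<noteq> \<zero>" shows "[k] \<cdot> x = \<zero> \<longleftrightarrow> p dvd k"
proof
  assume k: "[k] \<cdot> x = \<zero>"
  show "p dvd k"
  proof (rule ccontr)
    assume "\<not> p dvd k"
    then have "coprime k p" using prime by (metis coprime_commute prime_imp_coprime)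
    then have "add.ord x = 1"
      using k char_dvd[OF x(1), of p] x(1) add.pow_eq_id[of x]
      by (metis coprime_common_divisor_nat dvd_refl nat_dvd_1_iff_1)
    then have "[(1::nat)] \<cdot> x = \<zero>" using add.pow_eq_id[OF x(1), of 1] by simp
    then show False using x by simp
  qed
qed (use char_dvd x in auto)

lemma freshman:
  assumes x: "x \<in> carrier R" and y: "y \<in> carrier R"
  shows "(x \<oplus> y) [^] p = x [^] p \<oplus> y [^] p"
proof -
  \<comment> \<open>Writing \<open>p\<close> as \<open>q + 2\<close> isolates the two outer terms of
    the binomial sum; all coefficients in between are divisible by \<open>p\<close>.\<close>
  obtain q where q: "p = Suc (Suc q)" using p_gt_1 by (metis Suc_lessE less_imp_Suc_add)
  let ?g = "\<lambda>k. [(p choose k)] \<cdot> (x [^] k \<otimes> y [^] (p - k))"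
  have cl [simp]: "\<And>k. ?g k \<in> carrier R" using x y by auto
  have dvd: "p dvd (p choose Suc k)" if "k \<le> q" for k
    by (rule dvd_choose_prime) (use that q prime in auto)
  have "(\<Oplus>k\<in>{..q}. ?g (Suc k)) = (\<Oplus>k\<in>{..q}. \<zero>)"
    using x y by (intro finsum_cong') (auto intro!: char_dvd dvd simp del: binomial_Suc_Suc)
  then have *: "(\<Oplus>k\<in>{..q}. ?g (Suc k)) = \<zero>" by simp
  have "(x \<oplus> y) [^] p = (\<Oplus>k\<in>{..Suc (Suc q)}. ?g k)"
    using binomial_theorem[OF x y, of p] q by simp
  also have "\<dots> = ?g (Suc (Suc q)) \<oplus> ((\<Oplus>k\<in>{..q}. ?g (Suc k)) \<oplus> ?g 0)"
    by (subst finsum_Suc, simp, subst finsum_Suc2, simp_all)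
  also have "\<dots> = x [^] p \<oplus> y [^] p" unfolding * using x y q by simp
  finally show ?thesis .
qed

text \<open>The iterate \<sigma>^i of the Frobenius map; the closed form is the one that
  \<open>inv_frobenius_list\<close> uses.\<close>

definition frob :: "nat \<Rightarrow> 'a \<Rightarrow> 'a" where "frob i x = x [^] (p ^ i)"

lemma frob_closed [simp]: "x \<in> carrier R \<Longrightarrow> frob i x \<in> carrier R"
  by (simp add: frob_def)

lemma frob_0 [simp]: "x \<in> carrier R \<Longrightarrow> frob 0 x = x"
  by (simp add: frob_def)

lemma frob_frob: "x \<in> carrier R \<Longrightarrow> frob i (frob j x) = frob (i + j) x"
  by (simp add: frob_def nat_pow_pow power_add mult.commute)

lemma frob_mult [simp]:
  "\<lbrakk>x \<in> carrier R; y \<in> carrier R\<rbrakk> \<Longrightarrow> frob i (x \<otimes> y) = frob i x \<otimes> frob i y"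
  by (simp add: frob_def nat_pow_distrib)

lemma frob_pow [simp]: "x \<in> carrier R \<Longrightarrow> frob i (x [^] (k::nat)) = frob i x [^] k"
  by (simp add: frob_def nat_pow_pow mult.commute)

lemma frob_add [simp]:
  "\<lbrakk>x \<in> carrier R; y \<in> carrier R\<rbrakk> \<Longrightarrow> frob i (x \<oplus> y) = frob i x \<oplus> frob i y"
proof (induction i)
  case (Suc i)
  have 1: "frob (Suc i) z = (frob i z) [^] p" if "z \<in> carrier R" for z
    using frob_frob[of z 1 i] that by (simp add: frob_def)
  show ?case using Suc by (simp add: 1 freshman)
qed simp

lemma frob_hom: "frob i \<in> ring_hom R R"
  by (rule ring_hom_memI) (simp_all, simp add: frob_def)

lemma frob_zero [simp]: "frob i \<zero> = \<zero>"
  by (rule ring_hom_zero[OF frob_hom ring_axioms ring_axioms])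

lemma frob_a_inv [simp]: "x \<in> carrier R \<Longrightarrow> frob i (\<ominus> x) = \<ominus> frob i x"
  by (rule minus_equality[symmetric]) (simp_all flip: frob_add add: l_neg)

lemma frob_fixed_mult: "x \<in> carrier R \<Longrightarrow> frob 1 x = x \<Longrightarrow> frob i x = x"
proof (induction i)
  case (Suc i) then show ?case using frob_frob[of x i 1] by simp
qed simp

text \<open>In a field with p^N elements, \<open>frob_sum x N\<close> is the absolute trace of
  \<open>x\<close>. Other lengths give the translation of an Artin-Schreier root under
  \<sigma>^i.\<close>

primrec frob_sum :: "'a \<Rightarrow> nat \<Rightarrow> 'a" where
  "frob_sum x 0 = \<zero>"
| "frob_sum x (Suc i) = frob_sum x i \<oplus> frob i x"

lemma frob_sum_closed [simp]: "x \<in> carrier R \<Longrightarrow> frob_sum x i \<in> carrier R"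
  by (induction i) auto

lemma frob_sum_add:
  assumes "x \<in> carrier R" "y \<in> carrier R"
  shows "frob_sum (x \<oplus> y) i = frob_sum x i \<oplus> frob_sum y i"
proof (induction i)
  case (Suc i)
  then show ?case
    using a_interchange[of "frob_sum x i" "frob_sum y i" "frob i x" "frob i y"] assms by simp
qed simp

lemma frob_sum_mult:
  assumes "k \<in> carrier R" "frob 1 k = k" "x \<in> carrier R"
  shows "frob_sum (k \<otimes> x) i = k \<otimes> frob_sum x i"
  using assms(1,3) frob_fixed_mult[OF assms(1,2)] by (induction i) (simp_all add: r_distr)

text \<open>One more Frobenius moves the sum along the orbit by one place: the first term
  \<open>x\<close> leaves and \<open>frob N x\<close>, which equals \<open>x\<close>,
  enters.\<close>

lemma frob_sum_frob:
  assumes "x \<in> carrier R" "frob N x = x"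
  shows "frob_sum (frob i x) N = frob_sum x N"
proof (induction i)
  case (Suc i)
  have shift: "frob_sum (frob 1 y) k \<oplus> y = frob_sum y k \<oplus> frob k y" if "y \<in> carrier R" for y k
  proof (induction k)
    case (Suc k)
    have "frob_sum (frob 1 y) (Suc k) \<oplus> y = (frob_sum (frob 1 y) k \<oplus> y) \<oplus> frob (Suc k) y"
      using that by (simp add: frob_frob a_ac)
    then show ?case using Suc that by simp
  qed (use that in simp)
  have "frob N (frob i x) = frob i x"
    using assms by (metis add.commute frob_frob)
  then have "frob_sum (frob 1 (frob i x)) N \<oplus> frob i x = frob_sum (frob i x) N \<oplus> frob i x"
    using shift[of "frob i x" N] assms by simp
  then have "frob_sum (frob 1 (frob i x)) N = frob_sum (frob i x) N"
    using assms by simp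
  then show ?case using Suc assms frob_frob[of x 1 i] by simp
qed (use assms in simp)

text \<open>Since \<open>frob 1 x = x \<oplus> a\<close>, each further Frobenius adds the next
  conjugate of \<open>a\<close>.\<close>

lemma frob_artin_schreier:
  assumes "x \<in> carrier R" "a \<in> carrier R" "x [^] p = x \<oplus> a"
  shows "frob i x = x \<oplus> frob_sum a i"
proof (induction i)
  case (Suc i)
  have "frob 1 x = x \<oplus> a" using assms by (simp add: frob_def)
  then have "frob (Suc i) x = frob i x \<oplus> frob i a"
    using frob_frob[OF assms(1), of i 1] frob_add[OF assms(1,2), of i] by simp
  then show ?case using assms(1,2) by (simp only: Suc frob_sum.simps) (simp add: a_assoc)
qed (use assms(1) in simp)

end

section \<open>Cardinality and dimension over a finite subfield\<close>

lemma (in abelian_group) minus_eq_minusI: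
  assumes "a \<in> carrier G" "b \<in> carrier G" "c \<in> carrier G" "d \<in> carrier G"
    and eq: "a \<oplus> b = c \<oplus> d"
  shows "a \<ominus> c = d \<ominus> b"
proof -
  have "a \<ominus> c = (a \<oplus> b) \<oplus> (\<ominus> b \<oplus> \<ominus> c)"
    using assms(1-4) by (simp add: a_minus_def a_assoc r_neg2)
  also have "\<dots> = (d \<oplus> \<ominus> b) \<oplus> (c \<oplus> \<ominus> c)"
    using assms(1-4) unfolding eq by (simp add: a_ac)
  finally show ?thesis using assms(1-4) by (simp add: a_minus_def r_neg)
qed

text \<open>Adjoining \<open>v\<close> outside \<open>E\<close> gives a bijective copy of
  \<open>K \<times> E\<close>: if an element had two representations with different coefficients of
  \<open>v\<close>, dividing by their difference would put \<open>v\<close> into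
  \<open>E\<close>.\<close>

lemma (in ring) dimension_card:
  assumes "dimension n K E" and "subfield K R" and "finite K"
  shows "finite E \<and> card E = card K ^ n"
  using assms
proof (induction rule: dimension.induct)
  case (Suc_dim v E n K)
  note K = Suc_dim.prems(1)
  note E = space_subgroup_props[OF K Suc_dim.hyps(3)]
  have Kc: "K \<subseteq> carrier R" using subringE(1)[OF subfieldE(1)[OF K]] .
  have im: "line_extension K v E = (\<lambda>(k, e). k \<otimes> v \<oplus> e) ` (K \<times> E)"
    unfolding line_extension_mem_iff set_eq_iff by auto
  have "inj_on (\<lambda>(k, e). k \<otimes> v \<oplus> e) (K \<times> E)"
  proof (rule inj_onI, clarify)
    fix k e k' e'
    assume *: "k \<in> K" "e \<in> E" "k' \<in> K" "e' \<in> E" and eq: "k \<otimes> v \<oplus> e = k' \<otimes> v \<oplus> e'"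
    have c: "k \<in> carrier R" "k' \<in> carrier R" "e \<in> carrier R" "e' \<in> carrier R"
      using * Kc E(1) by auto
    have "(k \<ominus> k') \<otimes> v = e' \<ominus> e"
      using minus_eq_minusI[OF _ _ _ _ eq] c Suc_dim.hyps(1) by (simp add: a_minus_def l_distr l_minus)
    then have dv: "(k \<ominus> k') \<otimes> v \<in> E" using * E by (simp add: a_minus_def)
    have kk: "k \<ominus> k' \<in> K" using * subringE(5,7)[OF subfieldE(1)[OF K]] by (simp add: a_minus_def)
    have "k = k'"
    proof (rule ccontr)
      assume "k \<noteq> k'"
      then have "k \<ominus> k' \<in> K - {\<zero>}" using kk c by simp
      from subfield_m_inv[OF K this] have i: "inv (k \<ominus> k') \<in> K" "inv (k \<ominus> k') \<otimes> (k \<ominus> k') = \<one>" by auto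
      have "inv (k \<ominus> k') \<otimes> ((k \<ominus> k') \<otimes> v) \<in> E" using E(5) i(1) dv by blast
      then show False
        using i Kc c Suc_dim.hyps(1,2) by (simp add: m_assoc[symmetric] subset_iff)
    qed
    then show "k = k' \<and> e = e'" using eq c Suc_dim.hyps(1) by simp
  qed
  then show ?case
    using Suc_dim.IH[OF Suc_dim.prems] Suc_dim.prems(2)
    unfolding im by (simp add: card_image card_cartesian_product)
qed auto

text \<open>Lagrange's theorem in the multiplicative group of \<open>E\<close>, with zero treated
  separately. It shows that a power of Frobenius is the identity on a finite field.\<close>

lemma (in ring) subfield_pow_card:
  assumes E: "subfield E R" "finite E" and x: "x \<in> E"
  shows "x [^] card E = x"
proof -
  interpret E: field "R\<lparr>carrier := E\<rparr>" using subfield_iff(2)[OF E(1)] .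
  interpret G: group "Multiplicative_Group.mult_of (R\<lparr>carrier := E\<rparr>)" using E.field_mult_group .
  have Ec: "E \<subseteq> carrier R" using subringE(1)[OF subfieldE(1)[OF E(1)]] .
  have pos: "0 < card E" using E x by (auto simp: card_gt_0_iff)
  show ?thesis
  proof (cases "x = \<zero>")
    case True
    then show ?thesis using pos nat_pow_Suc[of \<zero> "card E - 1"] by simp
  next
    case False
    have "x [^]\<^bsub>Multiplicative_Group.mult_of (R\<lparr>carrier := E\<rparr>)\<^esub> order (Multiplicative_Group.mult_of (R\<lparr>carrier := E\<rparr>)) = \<one>"
      using G.pow_order_eq_1[of x] x False by simp
    then have "x [^] (card E - 1) = \<one>"
      using E.order_mult_of E(2) by (simp add: order_def nat_pow_consistent[symmetric] Multiplicative_Group.nat_pow_mult_of)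
    then show ?thesis
      using x Ec pos nat_pow_Suc[of x "card E - 1"] by auto
  qed
qed

text \<open>Reading the list from its end, a vector already in the span of its successors is skipped
  and any other raises the dimension by one. Full dimension means that none was skipped.\<close>

lemma (in ring) dimension_Span_le:
  assumes K: "subfield K R" and Us: "set Us \<subseteq> carrier R"
  shows "\<exists>m \<le> length Us. dimension m K (Span K Us) \<and> (m = length Us \<longrightarrow> independent K Us)"
  using Us
proof (induction Us)
  case (Cons u Us)
  then obtain m where m: "m \<le> length Us" "dimension m K (Span K Us)" "m = length Us \<longrightarrow> independent K Us"
    by (auto simp del: Span.simps)
  show ?case
  proof (cases "u \<in> Span K Us")
    case True
    then have "Span K (u # Us) = Span K Us"
      using mono_Span_subset[OF K, of "u # Us" Us] mono_Span[OF K, of Us u]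
        Span_base_incl[OF K, of Us] Cons.prems by (simp del: Span.simps)
    then show ?thesis using m by (intro exI[of _ m]) (simp del: Span.simps)
  next
    case False
    then show ?thesis
      using m Cons.prems Suc_dim[OF _ False m(2)] li_Cons[OF _ False]
      by (intro exI[of _ "Suc m"]) simp
  qed
qed auto

lemma (in ring) independent_if_Span_dimension:
  assumes "subfield K R" "set Us \<subseteq> carrier R" "dimension (length Us) K (Span K Us)"
  shows "independent K Us"
  using dimension_Span_le[OF assms(1,2)] dimension_is_inj[OF assms(1) _ assms(3)] by blast

section \<open>Polynomial expressions in a generator\<close>

locale power_span = domain R for R (structure) + fixes E :: "'a set" and b :: 'a
  assumes subfield: "subfield E R" and gen_closed [simp]: "b \<in> carrier R"
begin

text \<open>The polynomial expressions in \<open>b\<close> over \<open>E\<close> of degree less than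
  \<open>k\<close>. The reversed order puts the top power first, so that \<open>low (Suc k)\<close>
  unfolds to a line extension of \<open>low k\<close>.\<close>

definition low :: "nat \<Rightarrow> 'a set" where
  "low k = Span E (map (\<lambda>i. b [^] i) (rev [0..<k]))"

lemmas E_subring = subfieldE(1)[OF subfield]
lemmas E_sub = subringE[OF E_subring]

lemma E_closed [simp]: "c \<in> E \<Longrightarrow> c \<in> carrier R"
  using E_sub(1) by blast

lemma gens_closed: "set (map (\<lambda>i. b [^] i) (rev [0..<k])) \<subseteq> carrier R"
  by auto

lemma low_0: "low 0 = {\<zero>}"
  by (simp add: low_def)

lemma low_Suc: "low (Suc k) = line_extension E (b [^] k) (low k)"
  by (simp add: low_def)

lemma low_Suc_iff: "x \<in> low (Suc k) \<longleftrightarrow> (\<exists>c\<in>E. \<exists>w\<in>low k. x = c \<otimes> b [^] k \<oplus> w)"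
  unfolding low_Suc line_extension_mem_iff ..

lemma low_closed [simp]: "w \<in> low k \<Longrightarrow> w \<in> carrier R"
  using Span_subgroup_props(1)[OF subfield gens_closed] unfolding low_def by blast

lemma low_zero: "\<zero> \<in> low k"
  using Span_subgroup_props(2)[OF subfield gens_closed] unfolding low_def .

lemma low_add: "v \<in> low k \<Longrightarrow> w \<in> low k \<Longrightarrow> v \<oplus> w \<in> low k"
  using Span_subgroup_props(3)[OF subfield gens_closed] unfolding low_def .

lemma low_a_inv: "w \<in> low k \<Longrightarrow> \<ominus> w \<in> low k"
  using Span_subgroup_props(4)[OF subfield gens_closed] unfolding low_def .

lemma low_minus: "v \<in> low k \<Longrightarrow> w \<in> low k \<Longrightarrow> v \<ominus> w \<in> low k"
  unfolding a_minus_def by (intro low_add low_a_inv)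

lemma low_smult: "c \<in> E \<Longrightarrow> w \<in> low k \<Longrightarrow> c \<otimes> w \<in> low k"
  using Span_smult_closed[OF subfield gens_closed] unfolding low_def .

lemma low_monomial_add: "c \<in> E \<Longrightarrow> w \<in> low k \<Longrightarrow> c \<otimes> b [^] k \<oplus> w \<in> low (Suc k)"
  unfolding low_Suc_iff by blast

lemma low_mono_Suc: "w \<in> low k \<Longrightarrow> w \<in> low (Suc k)"
  using low_monomial_add[OF E_sub(2), of w k] by simp

lemma low_mono: "i \<le> k \<Longrightarrow> low i \<subseteq> low k"
  by (induction rule: dec_induct) (auto dest: low_mono_Suc)

lemma low_monomial: "c \<in> E \<Longrightarrow> c \<otimes> b [^] k \<in> low (Suc k)"
  using low_monomial_add[OF _ low_zero, of c k] by simp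

lemma low_mult_gen:
  assumes "w \<in> low k" shows "w \<otimes> b \<in> low (Suc k)"
  using assms
proof (induction k arbitrary: w)
  case 0
  then show ?case by (simp add: low_0 low_zero)
next
  case (Suc k)
  then obtain c v where cv: "c \<in> E" "v \<in> low k" "w = c \<otimes> b [^] k \<oplus> v"
    unfolding low_Suc_iff by blast
  have "w \<otimes> b = c \<otimes> b [^] Suc k \<oplus> v \<otimes> b"
    unfolding cv(3) using cv(1,2) by (simp add: l_distr m_assoc)
  then show ?case using low_monomial_add[OF cv(1) Suc.IH[OF cv(2)]] by simp
qed

lemma eval_low: "set l \<subseteq> E \<Longrightarrow> eval l b \<in> low (length l)"
  by (induction l) (auto simp: low_0 low_monomial_add simp del: nat_pow_Suc)

text \<open>The two top terms of the binomial expansion. After subtraction of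
  \<open>b [^] Suc k\<close> the second one leads, and its coefficient
  \<open>[Suc k] \<cdot> s\<close> governs how \<open>\<Delta>\<close> acts on leading
  coefficients.\<close>

lemma pow_shift_second_order:
  assumes s: "s \<in> E"
  shows "\<exists>w\<in>low k. (b \<oplus> s) [^] Suc k = b [^] Suc k \<oplus> (([Suc k] \<cdot> s) \<otimes> b [^] k \<oplus> w)"
proof (induction k)
  case 0
  show ?case using s by (intro bexI[of _ \<zero>]) (simp_all add: low_0)
next
  case (Suc k)
  then obtain w where w: "w \<in> low k"
    and eq: "(b \<oplus> s) [^] Suc k = b [^] Suc k \<oplus> (([Suc k] \<cdot> s) \<otimes> b [^] k \<oplus> w)" by blast
  let ?B = "b [^] k" and ?a = "[Suc k] \<cdot> s"
  have a: "?a \<in> E" using s by (induction k) (auto intro: E_sub)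
  have c: "s \<in> carrier R" "?a \<in> carrier R" "?B \<in> carrier R" "w \<in> carrier R" "b \<in> carrier R"
    using s w a by auto
  \<comment> \<open>The terms of formal degree at most \<open>k\<close> in the product of the
    expansion with \<open>b \<oplus> s\<close>.\<close>
  define w' where "w' = (s \<otimes> ?a) \<otimes> ?B \<oplus> (w \<otimes> b \<oplus> s \<otimes> w)"
  have w': "w' \<in> low (Suc k)"
    unfolding w'_def
    by (rule low_add[OF low_monomial low_add[OF low_mult_gen[OF w] low_mono_Suc[OF low_smult[OF s w]]]])
      (rule E_sub(6)[OF s a])
  have "(b \<oplus> s) [^] Suc (Suc k) = (b [^] Suc k \<oplus> (?a \<otimes> ?B \<oplus> w)) \<otimes> (b \<oplus> s)"
    using eq by simp
  also have "\<dots> = b [^] Suc (Suc k) \<oplus> ((?a \<otimes> b [^] Suc k \<oplus> s \<otimes> b [^] Suc k) \<oplus> w')"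
    unfolding w'_def using c by (simp add: l_distr r_distr m_ac a_ac)
  also have "?a \<otimes> b [^] Suc k \<oplus> s \<otimes> b [^] Suc k = ([Suc (Suc k)] \<cdot> s) \<otimes> b [^] Suc k"
    using c by (simp add: l_distr)
  finally show ?case using w' by blast
qed

lemma pow_shift:
  assumes s: "s \<in> E"
  shows "\<exists>w\<in>low k. (b \<oplus> s) [^] k = b [^] k \<oplus> w"
proof (cases k)
  case 0
  then show ?thesis by (simp add: low_0)
next
  case (Suc i)
  obtain w where w: "w \<in> low i"
    and eq: "(b \<oplus> s) [^] Suc i = b [^] Suc i \<oplus> (([Suc i] \<cdot> s) \<otimes> b [^] i \<oplus> w)"
    using pow_shift_second_order[OF s] by blast
  have "[Suc i] \<cdot> s \<in> E" using s by (induction i) (auto intro: E_sub)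
  then show ?thesis using low_monomial_add[OF _ w] eq Suc by blast
qed

end

section \<open>Frobenius on an Artin-Schreier extension\<close>

context char_field
begin

lemma frob_add_pow:
  assumes "x \<in> carrier R" shows "frob i ([(k::nat)] \<cdot> x) = [k] \<cdot> frob i x"
  by (induction k) (use assms in auto)

lemma frob_frob_sum:
  assumes "x \<in> carrier R" shows "frob j (frob_sum x i) = frob_sum (frob j x) i"
  by (induction i) (use assms in \<open>auto simp: frob_frob add.commute\<close>)

text \<open>\<open>frob 1\<close> fixes \<open>K\<close> pointwise and is therefore
  \<open>K\<close>-linear.\<close>

lemma frob_Span:
  assumes K: "subfield K R" "\<And>k. k \<in> K \<Longrightarrow> frob 1 k = k" and Us: "set Us \<subseteq> carrier R"
    and x: "x \<in> Span K Us"
  shows "frob 1 x \<in> Span K (map (frob 1) Us)"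
  using Us x
proof (induction Us arbitrary: x)
  case Nil
  then show ?case by simp
next
  case (Cons u Us)
  have Us: "set Us \<subseteq> carrier R" "u \<in> carrier R" using Cons.prems(1) by simp_all
  have Span_Cons: "Span K (u' # Vs) = line_extension K u' (Span K Vs)" for u' Vs
    by (simp only: Span.simps foldr.simps comp_apply)
  obtain k v where x: "k \<in> K" "v \<in> Span K Us" "x = k \<otimes> u \<oplus> v"
    using Cons.prems(2) unfolding Span_Cons line_extension_mem_iff by blast
  have c: "k \<in> carrier R" "v \<in> carrier R"
    using x(1,2) subringE(1)[OF subfieldE(1)[OF K(1)]] Span_subgroup_props(1)[OF K(1) Us(1)]
    by blast+
  have "frob 1 x = k \<otimes> frob 1 u \<oplus> frob 1 v"
    unfolding x(3) using c Us(2) K(2)[OF x(1)] by simp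
  then show ?case
    using x(1) Cons.IH[OF Us(1) x(2)]
    unfolding list.map Span_Cons line_extension_mem_iff by blast
qed

text \<open>The conjugates of \<open>g\<close> are permuted cyclically: \<open>frob 1\<close> takes
  each to the next and the last back to \<open>g\<close>, because
  \<open>frob N g = g\<close>.\<close>

lemma frob_orbit_Span_closed:
  assumes K: "subfield K R" "\<And>k. k \<in> K \<Longrightarrow> frob 1 k = k"
    and g: "g \<in> carrier R" "frob N g = g"
    and x: "x \<in> Span K (map (\<lambda>i. frob i g) [0..<N])"
  shows "frob i x \<in> Span K (map (\<lambda>i. frob i g) [0..<N])"
proof -
  let ?Us = "map (\<lambda>i. frob i g) [0..<N]"
  have Us: "set ?Us \<subseteq> carrier R" using g(1) by auto
  have xc: "x \<in> carrier R" using x Span_subgroup_props(1)[OF K(1) Us] by blast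
  show ?thesis
  proof (induction i)
    case 0
    show ?case unfolding frob_0[OF xc] by (rule x)
  next
    case (Suc i)
    have "frob (Suc i) x = frob 1 (frob i x)" using xc by (simp add: frob_frob)
    also have "\<dots> \<in> Span K (map (frob 1) ?Us)" by (rule frob_Span[OF K Us Suc])
    also have "Span K (map (frob 1) ?Us) \<subseteq> Span K ?Us"
    proof (rule mono_Span_subset[OF K(1) _ Us])
      have "frob (Suc j) g \<in> set ?Us" if "j < N" for j
      proof (cases "Suc j = N")
        case True
        then have "frob (Suc j) g = frob 0 g" using g by simp
        then show ?thesis using that by auto
      next
        case False
        then have "Suc j \<in> set [0..<N]" using that by simp
        then show ?thesis unfolding set_map by (rule imageI)
      qed
      then have "frob 1 (frob j g) \<in> set ?Us" if "j < N" for j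
        using that g(1) by (simp only: frob_frob plus_1_eq_Suc)
      then have "\<forall>j\<in>{0..<N}. frob 1 (frob j g) \<in> set ?Us" by simp
      then have "set (map (frob 1) ?Us) \<subseteq> set ?Us" by (simp only: set_map set_upt) blast
      then show "set (map (frob 1) ?Us) \<subseteq> Span K ?Us" using Span_base_incl[OF K(1) Us] by blast
    qed
    finally show ?case .
  qed
qed

end

text \<open>\<open>R\<close> stands for F(\<beta>) and \<open>E\<close> for the image of
  \<open>F\<close>. The cardinalities make \<sigma>^n the identity on \<open>E\<close> and
  \<sigma>^(np) the identity on \<open>R\<close>; \<open>low_p\<close> says that every element is a
  polynomial in \<open>\<beta>\<close> of degree less than \<open>p\<close>.\<close>

locale artin_schreier_tower = char_field R p + power_span R E \<beta>
  for R (structure) and p E \<beta> +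
  fixes n :: nat and \<alpha> :: 'a
  assumes n_pos: "0 < n" and card_E: "card E = p ^ n" and card_R: "card (carrier R) = p ^ (n * p)"
    and \<alpha>: "\<alpha> \<in> E" and root: "\<beta> [^] p = \<beta> \<oplus> \<alpha>" and low_p: "low p = carrier R"
begin

lemma finite_carrier: "finite (carrier R)"
  using card_R by (metis card.infinite less_numeral_extra(3) p_pos zero_less_power)

lemma finite_E: "finite E"
  using finite_carrier E_sub(1) finite_subset by blast

lemma frob_E_fixed: "c \<in> E \<Longrightarrow> frob n c = c"
  using subfield_pow_card[OF subfield finite_E] by (simp add: frob_def card_E)

lemma frob_fixed: "x \<in> carrier R \<Longrightarrow> frob (n * p) x = x"
  using subfield_pow_card[OF carrier_is_subfield finite_carrier] by (simp add: frob_def card_R)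

lemma frob_E [simp]: "c \<in> E \<Longrightarrow> frob i c \<in> E"
proof -
  assume c: "c \<in> E"
  have "c [^] (k::nat) \<in> E" for k by (induction k) (use c in \<open>auto intro: E_sub\<close>)
  then show ?thesis by (simp add: frob_def)
qed

lemma frob_sum_E: "c \<in> E \<Longrightarrow> frob_sum c i \<in> E"
  by (induction i) (auto intro: E_sub)

text \<open>The absolute trace of \<open>\<alpha>\<close> in \<open>E\<close>, which is also the
  amount by which \<sigma>^n translates \<open>\<beta>\<close>.\<close>

definition t where "t = frob_sum \<alpha> n"

lemma t_E: "t \<in> E" and t_closed [simp]: "t \<in> carrier R"
  using frob_sum_E[OF \<alpha>] unfolding t_def by (auto simp: \<alpha>)

lemma frob_gen: "frob i \<beta> = \<beta> \<oplus> frob_sum \<alpha> i"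
  by (rule frob_artin_schreier) (simp_all add: root \<alpha>)

lemma frob_gen_n: "frob n \<beta> = \<beta> \<oplus> t"
  unfolding t_def by (rule frob_gen)

lemma frob_t: "frob 1 t = t"
  unfolding t_def using \<alpha> frob_sum_frob[of \<alpha> n 1] by (simp add: frob_frob_sum frob_E_fixed)

text \<open>Frobenius translates \<open>\<beta>\<close> by an element of \<open>E\<close>, so it
  conjugates the leading coefficient and disturbs only lower degrees.\<close>

lemma frob_monomial:
  assumes "c \<in> E"
  shows "\<exists>w\<in>low k. frob i (c \<otimes> \<beta> [^] k) = frob i c \<otimes> \<beta> [^] k \<oplus> w"
proof -
  obtain w where w: "w \<in> low k" "(\<beta> \<oplus> frob_sum \<alpha> i) [^] k = \<beta> [^] k \<oplus> w"
    using pow_shift[OF frob_sum_E[OF \<alpha>]] by blast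
  have "frob i (c \<otimes> \<beta> [^] k) = frob i c \<otimes> \<beta> [^] k \<oplus> frob i c \<otimes> w"
    using assms w(1) by (simp add: frob_gen w(2) r_distr)
  then show ?thesis using low_smult[OF _ w(1)] assms by auto
qed

lemma frob_low: "w \<in> low k \<Longrightarrow> frob i w \<in> low k"
proof (induction k arbitrary: w)
  case 0
  then show ?case by (simp add: low_0)
next
  case (Suc k)
  then obtain c v where cv: "c \<in> E" "v \<in> low k" "w = c \<otimes> \<beta> [^] k \<oplus> v"
    unfolding low_Suc_iff by blast
  obtain w' where w': "w' \<in> low k" "frob i (c \<otimes> \<beta> [^] k) = frob i c \<otimes> \<beta> [^] k \<oplus> w'"
    using frob_monomial[OF cv(1)] by blast
  have "frob i w = frob i c \<otimes> \<beta> [^] k \<oplus> (w' \<oplus> frob i v)"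
    unfolding cv(3) using cv(1,2) w' by (simp add: a_assoc del: frob_mult)
  then show ?case
    using low_monomial_add[OF frob_E[OF cv(1)] low_add[OF w'(1) Suc.IH[OF cv(2)]]] by simp
qed

definition \<Delta> where "\<Delta> x = frob n x \<ominus> x"

lemma \<Delta>_closed [simp]: "x \<in> carrier R \<Longrightarrow> \<Delta> x \<in> carrier R"
  by (simp add: \<Delta>_def)

lemma \<Delta>_add: "x \<in> carrier R \<Longrightarrow> y \<in> carrier R \<Longrightarrow> \<Delta> (x \<oplus> y) = \<Delta> x \<oplus> \<Delta> y"
  using a_interchange[of "frob n x" "frob n y" "\<ominus> x" "\<ominus> y"]
  by (simp add: \<Delta>_def a_minus_def minus_add)

text \<open>\<sigma>^n fixes \<open>c\<close> and sends \<open>\<beta>\<close> to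
  \<open>\<beta> \<oplus> t\<close>, so the top terms cancel and the second term of the expansion
  becomes the leading one.\<close>

lemma \<Delta>_monomial:
  assumes c: "c \<in> E"
  shows "\<exists>w\<in>low k. \<Delta> (c \<otimes> \<beta> [^] Suc k) = (c \<otimes> ([Suc k] \<cdot> t)) \<otimes> \<beta> [^] k \<oplus> w"
proof -
  obtain w where w: "w \<in> low k"
    "(\<beta> \<oplus> t) [^] Suc k = \<beta> [^] Suc k \<oplus> (([Suc k] \<cdot> t) \<otimes> \<beta> [^] k \<oplus> w)"
    using pow_shift_second_order[OF t_E] by blast
  let ?r = "([Suc k] \<cdot> t) \<otimes> \<beta> [^] k"
  have cl: "c \<in> carrier R" "?r \<in> carrier R" "w \<in> carrier R" "\<beta> [^] Suc k \<in> carrier R"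
    using c w(1) by auto
  have "frob n (c \<otimes> \<beta> [^] Suc k) = c \<otimes> (\<beta> \<oplus> t) [^] Suc k"
    using frob_mult[OF cl(1,4), of n] frob_pow[of \<beta> n "Suc k"] by (simp add: frob_E_fixed[OF c] frob_gen_n)
  also have "\<dots> = c \<otimes> (\<beta> [^] Suc k) \<oplus> (c \<otimes> ?r \<oplus> c \<otimes> w)"
    unfolding w(2) using cl by (simp add: r_distr del: nat_pow_Suc add.nat_pow_Suc)
  finally have "frob n (c \<otimes> \<beta> [^] Suc k) = c \<otimes> (\<beta> [^] Suc k) \<oplus> (c \<otimes> ?r \<oplus> c \<otimes> w)" .
  moreover have "(a \<oplus> d) \<ominus> a = d" if "a \<in> carrier R" "d \<in> carrier R" for a d
    using minus_eq_minusI[of "a \<oplus> d" \<zero> a d] that by (simp add: a_minus_def)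
  ultimately have "\<Delta> (c \<otimes> \<beta> [^] Suc k) = c \<otimes> ?r \<oplus> c \<otimes> w"
    unfolding \<Delta>_def using cl by (simp del: nat_pow_Suc add.nat_pow_Suc)
  moreover have "c \<otimes> ?r = (c \<otimes> ([Suc k] \<cdot> t)) \<otimes> \<beta> [^] k"
    using cl(1) by (simp add: m_assoc)
  ultimately show ?thesis using low_smult[OF c w(1)] by auto
qed

lemma \<Delta>_low: "w \<in> low (Suc k) \<Longrightarrow> \<Delta> w \<in> low k"
proof (induction k arbitrary: w)
  case 0
  then obtain c where "c \<in> E" "w = c" by (auto simp: low_Suc_iff low_0)
  then show ?case by (simp add: \<Delta>_def frob_E_fixed low_0)
next
  case (Suc k)
  obtain c v where cv: "c \<in> E" "v \<in> low (Suc k)" "w = c \<otimes> \<beta> [^] Suc k \<oplus> v"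
    using Suc.prems unfolding low_Suc_iff[of w "Suc k"] by blast
  obtain w' where w': "w' \<in> low k"
    "\<Delta> (c \<otimes> \<beta> [^] Suc k) = (c \<otimes> ([Suc k] \<cdot> t)) \<otimes> \<beta> [^] k \<oplus> w'"
    using \<Delta>_monomial[OF cv(1)] by blast
  have "[Suc k] \<cdot> t \<in> E" using t_E by (induction k) (auto intro: E_sub)
  then have "\<Delta> (c \<otimes> \<beta> [^] Suc k) \<in> low (Suc k)"
    unfolding w'(2) using E_sub(6) cv(1) w'(1) by (intro low_monomial_add) blast+
  moreover have "\<Delta> v \<in> low (Suc k)"
    using low_mono_Suc[OF Suc.IH[OF cv(2)]] .
  moreover have "\<Delta> w = \<Delta> (c \<otimes> \<beta> [^] Suc k) \<oplus> \<Delta> v"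
    unfolding cv(3) using cv(1,2) by (intro \<Delta>_add) auto
  ultimately show ?case using low_add by simp
qed

text \<open>If \<open>t\<close> vanished, \<sigma>^n would fix \<open>\<beta>\<close> and hence all
  of \<open>R\<close>. Every nonzero element would be a root of x^(p^n - 1) - 1, too many for the
  degree since \<open>R\<close> has p^(np) elements.\<close>

lemma t_nonzero: "t \<noteq> \<zero>"
proof
  assume t: "t = \<zero>"
  have fix_low: "frob n w = w" if "w \<in> low k" for k w
    using that
  proof (induction k arbitrary: w)
    case (Suc k)
    then obtain c v where cv: "c \<in> E" "v \<in> low k" "w = c \<otimes> \<beta> [^] k \<oplus> v"
      unfolding low_Suc_iff by blast
    then show ?case using Suc.IH[OF cv(2)] frob_gen_n t by (simp add: frob_E_fixed)
  qed (simp add: low_0)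
  have pn: "1 < p ^ n" using one_less_power[OF _ n_pos, of p] p_gt_1 by simp
  have "x [^] (p ^ n - 1) = \<one>" if x: "x \<in> carrier R" "x \<noteq> \<zero>" for x
  proof -
    have "x [^] (p ^ n - 1) \<otimes> x = \<one> \<otimes> x"
      using fix_low[of x p] low_p x nat_pow_Suc[of x "p ^ n - 1"] pn by (simp add: frob_def)
    then show ?thesis using x m_rcancel by blast
  qed
  then have "carrier R - {\<zero>} \<subseteq> {x \<in> carrier R. x [^] (p ^ n - 1) = \<one>}" by auto
  then have "card (carrier R - {\<zero>}) \<le> card {x \<in> carrier R. x [^] (p ^ n - 1) = \<one>}"
    by (rule card_mono[rotated]) (simp add: finite_carrier)
  also have "\<dots> \<le> p ^ n - 1"
    by (rule num_roots_le_deg[OF finite_carrier]) (use pn in simp)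
  finally have "p ^ (n * p) \<le> p ^ n"
    using pn by (simp add: finite_carrier card_R)
  then have "n * p \<le> n" using p_gt_1 by (simp add: power_le_imp_le_exp)
  then show False using n_pos p_gt_1 by simp
qed

text \<open>The factor that \<open>\<Delta>\<close> puts on the leading coefficient in degree
  \<open>k\<close>. Below \<open>p\<close> it can be divided out, and being fixed by Frobenius it
  survives conjugation unchanged.\<close>

lemma add_pow_t:
  assumes "0 < k" "k < p"
  shows "[k] \<cdot> t \<in> E" "[k] \<cdot> t \<noteq> \<zero>" "frob 1 ([k] \<cdot> t) = [k] \<cdot> t"
proof -
  show "[k] \<cdot> t \<in> E" using t_E by (induction k) (auto intro: E_sub)
  show "[k] \<cdot> t \<noteq> \<zero>"
    using add_pow_eq_zero_iff[OF t_closed t_nonzero] assms by (auto dest: dvd_imp_le)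
  show "frob 1 ([k] \<cdot> t) = [k] \<cdot> t" by (simp only: frob_add_pow[OF t_closed] frob_t)
qed

end

section \<open>Spanning by conjugates and vanishing traces\<close>

context artin_schreier_tower
begin

text \<open>The set collects the coefficients in degree \<open>k\<close> that are reached after
  scaling by \<open>u\<close>. Its additive closure lets \<open>Span_min\<close> extend membership
  from the conjugates of \<open>c\<close> to all of \<open>E\<close>.\<close>

lemma subgroup_scaled_monomials:
  assumes S: "subgroup S (add_monoid R)" and u: "u \<in> carrier R"
  shows "subgroup {x \<in> E. (u \<otimes> x) \<otimes> \<beta> [^] (k::nat) \<in> S} (add_monoid R)"
proof (rule add.subgroupI)
  interpret S: subgroup S "add_monoid R" by fact
  let ?T = "{x \<in> E. (u \<otimes> x) \<otimes> \<beta> [^] k \<in> S}"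
  show "?T \<subseteq> carrier R" by auto
  show "?T \<noteq> {}" using S.one_closed u E_sub(2) by auto
  show "\<ominus> x \<in> ?T" if "x \<in> ?T" for x
    using that S.m_inv_closed[of "(u \<otimes> x) \<otimes> \<beta> [^] k", folded a_inv_def] u E_sub(5)
    by (auto simp: r_minus l_minus)
  show "x \<oplus> y \<in> ?T" if "x \<in> ?T" "y \<in> ?T" for x y
    using that S.m_closed[of "(u \<otimes> x) \<otimes> \<beta> [^] k" "(u \<otimes> y) \<otimes> \<beta> [^] k"] u E_sub(7)
    by (auto simp: r_distr l_distr)
qed

lemma orbit_Span_eq_carrier:
  assumes K: "subfield K R" "\<And>k. k \<in> K \<Longrightarrow> frob 1 k = k" "K \<subseteq> E"
    and c: "c \<in> E" "Span K (map (\<lambda>i. frob i c) [0..<n]) = E"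
    and g: "w0 \<in> low (p - 1)" "g = c \<otimes> \<beta> [^] (p - 1) \<oplus> w0"
  shows "Span K (map (\<lambda>i. frob i g) [0..<n * p]) = carrier R"
proof -
  define Us where "Us = map (\<lambda>i. frob i g) [0..<n * p]"
  define S where "S = Span K Us"
  have gc: "g \<in> carrier R" using c g by simp
  have Us: "set Us \<subseteq> carrier R" using gc by (auto simp: Us_def)
  have S_sub: "subgroup S (add_monoid R)" unfolding S_def by (rule Span_is_add_subgroup[OF K(1) Us])
  note Sp = Span_subgroup_props[OF K(1) Us, folded S_def]
  have S_smult: "k \<otimes> v \<in> S" if "k \<in> K" "v \<in> S" for k v
    using Span_smult_closed[OF K(1) Us] that unfolding S_def by blast
  have S_frob: "frob i x \<in> S" if "x \<in> S" for i x
    using that frob_orbit_Span_closed[OF K(1,2) gc frob_fixed[OF gc]] unfolding S_def Us_def by blast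
  have S_minus: "x \<ominus> y \<in> S" if "x \<in> S" "y \<in> S" for x y
    using Sp(3,4) that unfolding a_minus_def by blast
  have S_Delta: "\<Delta> x \<in> S" if "x \<in> S" for x
    unfolding \<Delta>_def by (intro S_minus S_frob that)
  have gS: "g \<in> S"
  proof -
    have "0 < n * p" using n_pos by simp
    then have "frob 0 g \<in> set Us" unfolding Us_def set_map set_upt by (intro imageI) simp
    then show ?thesis using Span_base_incl[OF K(1) Us] gc unfolding S_def by auto
  qed
  \<comment> \<open>Downward from degree \<open>p - 1\<close>: starting with \<open>g\<close>, each
    \<open>\<Delta>\<close> lowers the degree by one and multiplies \<open>u\<close> by
    \<open>[Suc k] \<cdot> t\<close>, so that \<open>u\<close> remains nonzero and fixed by
    Frobenius.\<close>
  have lead: "\<exists>u. u \<in> E \<and> u \<noteq> \<zero> \<and> frob 1 u = u \<and> (\<exists>w\<in>low k. (u \<otimes> c) \<otimes> \<beta> [^] k \<oplus> w \<in> S)"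
    if "k \<le> p - 1" for k
    using that
  proof (induction rule: inc_induct)
    case base
    show ?case
    proof (intro exI[of _ \<one>] conjI bexI[OF _ g(1)])
      show "frob 1 \<one> = \<one>" by (simp add: frob_def)
    qed (use E_sub(3) c(1) gS g(2) in auto)
  next
    case (step k)
    then obtain u w where u: "u \<in> E" "u \<noteq> \<zero>" "frob 1 u = u" and w: "w \<in> low (Suc k)"
      and z: "(u \<otimes> c) \<otimes> \<beta> [^] Suc k \<oplus> w \<in> S" by blast
    have uc: "u \<otimes> c \<in> E" using u(1) c(1) E_sub(6) by blast
    let ?T = "[Suc k] \<cdot> t"
    have T: "?T \<in> E" "?T \<noteq> \<zero>" "frob 1 ?T = ?T" using add_pow_t[of "Suc k"] step.hyps by auto
    obtain w1 where w1: "w1 \<in> low k"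
      "\<Delta> ((u \<otimes> c) \<otimes> \<beta> [^] Suc k) = ((u \<otimes> c) \<otimes> ?T) \<otimes> \<beta> [^] k \<oplus> w1"
      using \<Delta>_monomial[OF uc] by blast
    have "\<Delta> ((u \<otimes> c) \<otimes> \<beta> [^] Suc k \<oplus> w) = \<Delta> ((u \<otimes> c) \<otimes> \<beta> [^] Suc k) \<oplus> \<Delta> w"
      by (rule \<Delta>_add) (use u c w in auto)
    also have "\<dots> = ((u \<otimes> c) \<otimes> ?T) \<otimes> \<beta> [^] k \<oplus> (w1 \<oplus> \<Delta> w)"
      unfolding w1(2) by (rule a_assoc) (use T(1) uc w w1(1) in \<open>simp_all del: add.nat_pow_Suc\<close>)
    also have "(u \<otimes> c) \<otimes> ?T = (u \<otimes> ?T) \<otimes> c"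
      using u(1) c(1) T(1) by (simp add: m_ac del: add.nat_pow_Suc)
    finally have "((u \<otimes> ?T) \<otimes> c) \<otimes> \<beta> [^] k \<oplus> (w1 \<oplus> \<Delta> w) \<in> S"
      using S_Delta[OF z] by simp
    moreover have "w1 \<oplus> \<Delta> w \<in> low k" by (rule low_add[OF w1(1) \<Delta>_low[OF w]])
    moreover have "u \<otimes> ?T \<in> E" by (rule E_sub(6)[OF u(1) T(1)])
    moreover have "u \<otimes> ?T \<noteq> \<zero>" using integral[of u ?T] u T by auto
    moreover have "frob 1 (u \<otimes> ?T) = u \<otimes> ?T"
      by (subst frob_mult) (use u T in \<open>simp_all del: add.nat_pow_Suc One_nat_def\<close>)
    ultimately show ?case by blast
  qed
  \<comment> \<open>Upward: the conjugates of the element from \<open>lead\<close> differ from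
    \<open>(u \<otimes> frob i c) \<otimes> \<beta> [^] k\<close> by elements of
    \<open>low k\<close>, which already lies in \<open>S\<close>. As the \<open>frob i c\<close>
    span \<open>E\<close>, all of degree \<open>k\<close> is reached.\<close>
  have low_S: "low k \<subseteq> S" if "k \<le> p" for k
    using that
  proof (induction k)
    case 0
    then show ?case using Sp(2) by (simp add: low_0)
  next
    case (Suc k)
    then have k: "k \<le> p - 1" and IH: "low k \<subseteq> S" by auto
    obtain u w where u: "u \<in> E" "u \<noteq> \<zero>" "frob 1 u = u" and w: "w \<in> low k"
      and z: "(u \<otimes> c) \<otimes> \<beta> [^] k \<oplus> w \<in> S" using lead[OF k] by blast
    have uc: "u \<otimes> c \<in> E" by (rule E_sub(6)[OF u(1) c(1)])
    let ?T = "{x \<in> E. (u \<otimes> x) \<otimes> \<beta> [^] k \<in> S}"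
    have conj: "frob i c \<in> ?T" for i
    proof -
      obtain w' where w': "w' \<in> low k"
        "frob i ((u \<otimes> c) \<otimes> \<beta> [^] k) = frob i (u \<otimes> c) \<otimes> \<beta> [^] k \<oplus> w'"
        using frob_monomial[OF uc] by blast
      have "frob i (u \<otimes> c) = u \<otimes> frob i c"
        using u c frob_fixed_mult[of u i] by simp
      then have eq: "frob i ((u \<otimes> c) \<otimes> \<beta> [^] k \<oplus> w) = (u \<otimes> frob i c) \<otimes> \<beta> [^] k \<oplus> (w' \<oplus> frob i w)"
        using w' w u c frob_add[of "(u \<otimes> c) \<otimes> \<beta> [^] k" w i]
        by (simp add: a_assoc del: frob_mult)
      have "w' \<oplus> frob i w \<in> S" using IH low_add[OF w'(1) frob_low[OF w]] by blast
      then have "((u \<otimes> frob i c) \<otimes> \<beta> [^] k \<oplus> (w' \<oplus> frob i w)) \<ominus> (w' \<oplus> frob i w) \<in> S"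
        using S_frob[OF z, of i] S_minus unfolding eq by blast
      moreover have "((u \<otimes> frob i c) \<otimes> \<beta> [^] k \<oplus> (w' \<oplus> frob i w)) \<ominus> (w' \<oplus> frob i w)
          = (u \<otimes> frob i c) \<otimes> \<beta> [^] k"
        using u(1) c(1) w w'(1) by (simp add: a_minus_def a_assoc r_neg)
      ultimately show ?thesis using c(1) by simp
    qed
    have "Span K (map (\<lambda>i. frob i c) [0..<n]) \<subseteq> ?T"
    proof (rule Span_min[OF K(1)])
      show "set (map (\<lambda>i. frob i c) [0..<n]) \<subseteq> carrier R" using c(1) by auto
      show "subgroup ?T (add_monoid R)" using subgroup_scaled_monomials[OF S_sub] u(1) by simp
      show "K <#> set (map (\<lambda>i. frob i c) [0..<n]) \<subseteq> ?T"
      proof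
        fix x assume "x \<in> K <#> set (map (\<lambda>i. frob i c) [0..<n])"
        then obtain k' i where x: "k' \<in> K" "x = k' \<otimes> frob i c" by (auto simp: set_mult_def)
        have k'E: "k' \<in> E" using x(1) K(3) by blast
        have "(u \<otimes> x) \<otimes> \<beta> [^] k = k' \<otimes> ((u \<otimes> frob i c) \<otimes> \<beta> [^] k)"
          unfolding x(2) using k'E u(1) c(1) by (simp add: m_ac)
        then show "x \<in> ?T" using S_smult[OF x(1)] conj[of i] x(2) E_sub(6)[OF k'E] by auto
      qed
    qed
    then have T: "x \<in> E \<Longrightarrow> (u \<otimes> x) \<otimes> \<beta> [^] k \<in> S" for x using c(2) by blast
    show ?case
    proof
      fix x assume "x \<in> low (Suc k)"
      then obtain d v where x: "d \<in> E" "v \<in> low k" "x = d \<otimes> \<beta> [^] k \<oplus> v"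
        unfolding low_Suc_iff by blast
      \<comment> \<open>Division by \<open>u\<close> makes the coefficient arbitrary, since
        \<open>u\<close> is a unit of \<open>E\<close>.\<close>
      have i: "inv u \<in> E" "u \<otimes> inv u = \<one>"
        using subfield_m_inv[OF subfield, of u] u by auto
      have "(u \<otimes> (inv u \<otimes> d)) = d"
        using m_assoc[of u "inv u" d] i u(1) x(1) by simp
      then have "d \<otimes> \<beta> [^] k \<in> S" using T[OF E_sub(6)[OF i(1) x(1)]] by simp
      then show "x \<in> S" using IH x Sp(3) by auto
    qed
  qed
  show ?thesis using low_S[of p] low_p Sp(1) unfolding S_def Us_def by auto
qed

text \<open>The trace is unchanged by \<sigma>^n, so it kills the image of \<open>\<Delta>\<close>.
  Up to lower terms, every monomial of degree less than \<open>p - 1\<close> is such an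
  image.\<close>

lemma frob_sum_low:
  assumes "w \<in> low (p - 1)" shows "frob_sum w (n * p) = \<zero>"
proof -
  have tr_Delta: "frob_sum (\<Delta> x) (n * p) = \<zero>" if x: "x \<in> carrier R" for x
  proof -
    have "frob_sum (\<Delta> x) (n * p) \<oplus> frob_sum x (n * p) = frob_sum (frob n x) (n * p)"
      using x by (subst frob_sum_add[symmetric]) (simp_all add: \<Delta>_def a_minus_def a_assoc l_neg)
    also have "\<dots> = \<zero> \<oplus> frob_sum x (n * p)"
      using x by (simp add: frob_sum_frob frob_fixed)
    finally show ?thesis using x by (subst (asm) add.r_cancel) auto
  qed
  have "k \<le> p - 1 \<Longrightarrow> w \<in> low k \<Longrightarrow> frob_sum w (n * p) = \<zero>" for k w
  proof (induction k arbitrary: w)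
    case 0
    then show ?case using tr_Delta[of \<zero>] by (simp add: low_0 \<Delta>_def a_minus_def)
  next
    case (Suc k)
    obtain c v where cv: "c \<in> E" "v \<in> low k" "w = c \<otimes> \<beta> [^] k \<oplus> v"
      using Suc.prems(2) unfolding low_Suc_iff by blast
    let ?T = "[Suc k] \<cdot> t"
    have T: "?T \<in> E" "?T \<noteq> \<zero>" using add_pow_t[of "Suc k"] Suc.prems(1) p_gt_1 by auto
    have i: "inv ?T \<in> E" "inv ?T \<otimes> ?T = \<one>"
      using subfield_m_inv[OF subfield, of ?T] T by auto
    \<comment> \<open>An antiderivative for \<open>\<Delta>\<close>: the division by
      \<open>[Suc k] \<cdot> t\<close> is possible because \<open>Suc k\<close> is less than
      \<open>p\<close>.\<close>
    let ?c = "c \<otimes> inv ?T"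
    have cE: "?c \<in> E" by (rule E_sub(6)[OF cv(1) i(1)])
    obtain w' where w': "w' \<in> low k" "\<Delta> (?c \<otimes> \<beta> [^] Suc k) = (?c \<otimes> ?T) \<otimes> \<beta> [^] k \<oplus> w'"
      using \<Delta>_monomial[OF cE] by blast
    have "?c \<otimes> ?T = c"
      using m_assoc[of c "inv ?T" ?T] cv(1) i T(1) by (simp del: add.nat_pow_Suc)
    then have eq: "\<Delta> (?c \<otimes> \<beta> [^] Suc k) = c \<otimes> \<beta> [^] k \<oplus> w'" using w'(2) by simp
    have IH: "frob_sum x (n * p) = \<zero>" if "x \<in> low k" for x
      using Suc.IH[OF _ that] Suc.prems(1) by simp
    have "frob_sum (c \<otimes> \<beta> [^] k) (n * p) = frob_sum (c \<otimes> \<beta> [^] k \<oplus> w') (n * p)"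
      using cv(1) w'(1) IH by (simp add: frob_sum_add)
    also have "\<dots> = \<zero>" unfolding eq[symmetric] by (rule tr_Delta) (use cE in simp)
    finally show ?case unfolding cv(3) using cv IH by (simp add: frob_sum_add)
  qed
  then show ?thesis using assms by blast
qed

end

lemma (in ring) combine_ones_snoc:
  assumes "set Us \<subseteq> carrier R" "u \<in> carrier R"
  shows "combine (replicate (length Us) \<one> @ [\<one>]) (Us @ [u]) = combine (replicate (length Us) \<one>) Us \<oplus> u"
  using combine_append[of "replicate (length Us) \<one>" Us "[\<one>]" "[u]"] assms
  by (simp add: set_replicate_conv_if)

text \<open>The trace is the combination of the conjugates with all coefficients
  \<open>\<one>\<close>, which is nontrivial as soon as the list is nonempty.\<close>

lemma (in char_field) frob_sum_independent_nonzero: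
  assumes "subfield K R" "g \<in> carrier R" "0 < N" "independent K (map (\<lambda>i. frob i g) [0..<N])"
  shows "frob_sum g N \<noteq> \<zero>"
proof
  let ?Us = "map (\<lambda>i. frob i g)"
  have cmb: "combine (replicate N \<one>) (?Us [0..<N]) = frob_sum g N" for N
  proof (induction N)
    case (Suc N)
    have "set (?Us [0..<N]) \<subseteq> carrier R" using assms(2) by auto
    then show ?case
      using Suc combine_ones_snoc[of "?Us [0..<N]" "frob N g"] assms(2) by (simp add: replicate_append_same)
  qed simp
  assume "frob_sum g N = \<zero>"
  then have "set (take (length (?Us [0..<N])) (replicate N \<one>)) \<subseteq> {\<zero>}"
    using independent_imp_trivial_combine[OF assms(1,4), of "replicate N \<one>"] cmb[of N]
      subringE(3)[OF subfieldE(1)[OF assms(1)]] by (auto simp: set_replicate_conv_if)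
  then show False using assms(3) by simp
qed

section \<open>The element \<open>\<delta>\<close>\<close>

text \<open>Read the equation as z (z^(p-1) - 1) = a. It is applied to two roots,
  \<open>\<beta>\<close> itself and the translate used for the trace of
  \<open>\<delta>\<close>.\<close>

lemma (in char_field) artin_schreier_root_inverse:
  assumes a: "a \<in> carrier R" "a \<noteq> \<zero>" and z: "z \<in> carrier R" "z [^] p = z \<oplus> a"
  shows "z \<noteq> \<zero>" "inv z = inv a \<otimes> (z [^] (p - 1) \<ominus> \<one>)"
proof -
  have p: "z [^] p = z \<otimes> z [^] (p - 1)"
    using z(1) nat_pow_Suc2[of z "p - 1"] by simp
  show "z \<noteq> \<zero>"
  proof
    assume "z = \<zero>"
    then show False using z(2) a p by simp
  qed
  have ia: "inv a \<in> carrier R" "inv a \<otimes> a = \<one>"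
    using a field_Units by (auto intro: Units_inv_closed Units_l_inv)
  have "z \<otimes> (inv a \<otimes> (z [^] (p - 1) \<ominus> \<one>)) = inv a \<otimes> (z [^] p \<ominus> z)"
    using z(1) ia(1) unfolding p by (simp add: m_lcomm m_comm[of z "inv a"] r_distr r_minus a_minus_def)
  also have "z [^] p \<ominus> z = a"
    using minus_eq_minusI[of "z [^] p" \<zero> z a] z a by (simp add: a_minus_def)
  finally have "z \<otimes> (inv a \<otimes> (z [^] (p - 1) \<ominus> \<one>)) = \<one>" using ia by simp
  then show "inv z = inv a \<otimes> (z [^] (p - 1) \<ominus> \<one>)"
    using z(1) ia(1) by (intro comm_inv_char) auto
qed

text \<open>\<open>K\<close> is the prime field inside \<open>R\<close>, and \<open>dim\<close> is
  what turns a spanning list of length \<open>n * p\<close> into a basis.\<close>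

locale artin_schreier_step = artin_schreier_tower +
  fixes K :: "'a set" and b \<delta> :: 'a
  assumes K: "subfield K R" "\<And>k. k \<in> K \<Longrightarrow> frob 1 k = k" "K \<subseteq> E"
    and dim: "dimension (n * p) K (carrier R)"
    and \<alpha>_nonzero: "\<alpha> \<noteq> \<zero>" and Span_E: "Span K (map (\<lambda>i. frob i (inv \<alpha>)) [0..<n]) = E"
    and b: "b \<in> K" "b \<noteq> \<zero>" and \<delta>: "\<delta> = inv (inv \<beta> \<ominus> b)"
begin

definition \<gamma> where "\<gamma> = inv \<beta> \<ominus> b"

lemma inv_\<alpha>: "inv \<alpha> \<in> E"
  using subfield_m_inv(1)[OF subfield, of \<alpha>] \<alpha> \<alpha>_nonzero by simp

lemma b_E: "b \<in> E" using b K(3) by blast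

lemma E_low: assumes "c \<in> E" shows "c \<in> low (p - 1)"
proof -
  have "c \<in> low (Suc 0)" using low_monomial[OF assms, of 0] assms by simp
  \<comment> \<open>For \<open>p = 2\<close> the two sides agree: \<open>low (p - 1)\<close> still
    contains the constants.\<close>
  moreover have "Suc 0 \<le> p - 1" using p_gt_1 by linarith
  ultimately show ?thesis using low_mono by blast
qed

lemma \<beta>_nonzero: "\<beta> \<noteq> \<zero>" and inv_\<beta>: "inv \<beta> = inv \<alpha> \<otimes> (\<beta> [^] (p - 1) \<ominus> \<one>)"
  using artin_schreier_root_inverse[OF E_closed[OF \<alpha>] \<alpha>_nonzero gen_closed root] by blast+

lemma inv_\<beta>_closed [simp]: "inv \<beta> \<in> carrier R"
  using \<beta>_nonzero field_Units by (auto intro: Units_inv_closed)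

lemma \<gamma>_closed [simp]: "\<gamma> \<in> carrier R"
  using b_E by (simp add: \<gamma>_def)

text \<open>This isolates the leading coefficient \<open>inv \<alpha>\<close> in degree
  \<open>p - 1\<close>, the shape required by \<open>orbit_Span_eq_carrier\<close>.\<close>

lemma \<gamma>_eq: "\<gamma> = inv \<alpha> \<otimes> \<beta> [^] (p - 1) \<oplus> (\<ominus> (inv \<alpha>) \<ominus> b)"
  using inv_\<alpha> b_E unfolding \<gamma>_def inv_\<beta>
  by (simp add: a_minus_def r_distr r_minus a_assoc)

lemma \<gamma>_lower: "\<ominus> (inv \<alpha>) \<ominus> b \<in> low (p - 1)"
  by (intro low_minus low_a_inv E_low inv_\<alpha> b_E)

lemma \<gamma>_Span: "Span K (map (\<lambda>i. frob i \<gamma>) [0..<n * p]) = carrier R"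
  by (rule orbit_Span_eq_carrier[OF K inv_\<alpha> Span_E \<gamma>_lower \<gamma>_eq])

lemma \<gamma>_independent: "independent K (map (\<lambda>i. frob i \<gamma>) [0..<n * p])"
proof (rule independent_if_Span_dimension[OF K(1)])
  show "set (map (\<lambda>i. frob i \<gamma>) [0..<n * p]) \<subseteq> carrier R" by auto
  show "dimension (length (map (\<lambda>i. frob i \<gamma>) [0..<n * p])) K
      (Span K (map (\<lambda>i. frob i \<gamma>) [0..<n * p]))"
    unfolding \<gamma>_Span using dim by simp
qed

lemma \<gamma>_trace: "frob_sum \<gamma> (n * p) \<noteq> \<zero>"
  by (rule frob_sum_independent_nonzero[OF K(1) \<gamma>_closed _ \<gamma>_independent]) (use n_pos in simp)

lemma \<gamma>_nonzero: "\<gamma> \<noteq> \<zero>"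
  using \<gamma>_trace frob_sum_low[OF low_zero] by auto

lemma inv_\<delta>: "inv \<delta> = \<gamma>"
  using \<gamma>_nonzero field_Units unfolding \<delta> \<gamma>_def[symmetric] by (intro Units_inv_inv) simp

lemma \<delta>_closed [simp]: "\<delta> \<in> carrier R"
  using \<gamma>_nonzero field_Units unfolding \<delta> \<gamma>_def[symmetric] by (intro Units_inv_closed) simp

lemma \<delta>_orbit:
  "Span K (map (\<lambda>i. frob i (inv \<delta>)) [0..<n * p]) = carrier R"
  "independent K (map (\<lambda>i. frob i (inv \<delta>)) [0..<n * p])"
  unfolding inv_\<delta> by (rule \<gamma>_Span \<gamma>_independent)+

text \<open>With \<open>c = 1/b\<close> one has \<open>\<delta> = - c - c\<^sup>2/(\<beta> - c)\<close>, and \<open>\<beta> - c\<close> is again a root of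
  \<open>x\<^sup>p - x - \<alpha>\<close>, so \<open>1/(\<beta> - c)\<close> and \<open>\<gamma>\<close> have the same leading term.\<close>

lemma \<delta>_trace: "frob_sum \<delta> (n * p) \<noteq> \<zero>"
proof
  assume contr: "frob_sum \<delta> (n * p) = \<zero>"
  define c where "c = inv b"
  have c: "c \<in> K" "b \<otimes> c = \<one>" "c \<noteq> \<zero>"
    unfolding c_def using subfield_m_inv[OF K(1), of b] b by auto
  have cE: "c \<in> E" using c(1) K(3) by blast
  have cl: "c \<in> carrier R" "b \<in> carrier R" using cE b_E by auto
  define z where "z = \<beta> \<oplus> \<ominus> c"
  have z: "z \<in> carrier R" using cl by (simp add: z_def)
  \<comment> \<open>\<open>c\<close> is fixed by Frobenius, so the translate \<open>z\<close>
    satisfies the same equation as \<open>\<beta>\<close>.\<close>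
  have "frob 1 z = frob 1 \<beta> \<oplus> \<ominus> c"
    unfolding z_def using cl K(2)[OF c(1)] by (simp del: One_nat_def)
  then have zp: "z [^] p = z \<oplus> \<alpha>"
    using cl root unfolding z_def by (simp add: frob_def a_ac \<alpha>)
  note z_inv = artin_schreier_root_inverse[OF E_closed[OF \<alpha>] \<alpha>_nonzero z zp]
  define v where "v = inv z"
  have v: "v \<in> carrier R" "z \<otimes> v = \<one>"
    unfolding v_def using z z_inv(1) field_Units by (auto intro: Units_inv_closed Units_r_inv)
  have \<beta>v: "\<beta> \<otimes> v = \<one> \<oplus> c \<otimes> v"
  proof -
    have "z \<otimes> v \<oplus> c \<otimes> v = \<beta> \<otimes> v"
      unfolding z_def using cl v(1) by (simp add: l_distr l_minus a_assoc l_neg)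
    then show ?thesis using v(2) by simp
  qed
  obtain w where w: "w \<in> low (p - 1)" "z [^] (p - 1) = \<beta> [^] (p - 1) \<oplus> w"
    using pow_shift[OF E_sub(5)[OF cE]] unfolding z_def by blast
  have v_eq: "v = \<gamma> \<oplus> (inv \<alpha> \<otimes> w \<oplus> b)"
  proof -
    let ?o = "inv \<alpha>" and ?B = "\<beta> [^] (p - 1)"
    have o: "?o \<in> carrier R" using inv_\<alpha> by simp
    have w': "w \<in> carrier R" using w(1) by simp
    have "v = ?o \<otimes> ?B \<oplus> (?o \<otimes> w \<oplus> \<ominus> ?o)"
      unfolding v_def z_inv(2) w(2) using o w' by (simp add: a_minus_def r_distr r_minus a_assoc)
    also have "?o \<otimes> w \<oplus> \<ominus> ?o = (\<ominus> ?o \<ominus> b) \<oplus> (?o \<otimes> w \<oplus> b)"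
      using o w' cl(2) a_interchange[of "\<ominus> ?o" "\<ominus> b" "?o \<otimes> w" b]
      by (simp add: a_minus_def l_neg r_neg a_comm)
    finally show ?thesis unfolding \<gamma>_eq using o w' cl(2) by (simp add: a_assoc)
  qed
  have low': "inv \<alpha> \<otimes> w \<oplus> b \<in> low (p - 1)"
    by (intro low_add low_smult inv_\<alpha> w(1) E_low b_E)
  have tr_v: "frob_sum v (n * p) = frob_sum \<gamma> (n * p)"
    unfolding v_eq using low_closed[OF low'] frob_sum_low[OF low'] by (simp add: frob_sum_add)
  \<comment> \<open>\<open>d\<close> is to be \<open>\<ominus> \<delta>\<close>: it equals c
    \<beta>/(\<beta> - c), while \<open>\<gamma>\<close> equals - b (\<beta> - c)/\<beta> and b c =
    1.\<close>
  define d where "d = c \<oplus> (c \<otimes> c) \<otimes> v"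
  have d: "d \<in> carrier R" using cl v by (simp add: d_def)
  let ?i = "inv \<beta>"
  have "c \<otimes> v = (?i \<otimes> \<beta>) \<otimes> (c \<otimes> v)"
    using \<beta>_nonzero field_Units cl v(1) by (simp add: Units_l_inv)
  also have "\<dots> = (?i \<otimes> c) \<otimes> (\<beta> \<otimes> v)" using cl v(1) by (simp add: m_ac)
  also have "\<dots> = ?i \<otimes> d" unfolding \<beta>v d_def using cl v(1) by (simp add: r_distr m_assoc)
  finally have id: "?i \<otimes> d = c \<otimes> v" by simp
  have bd: "b \<otimes> d = \<one> \<oplus> c \<otimes> v"
  proof -
    have "b \<otimes> d = b \<otimes> c \<oplus> (b \<otimes> c) \<otimes> (c \<otimes> v)"
      unfolding d_def using cl v(1) by (simp add: r_distr m_assoc)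
    then show ?thesis using c(2) cl v(1) by simp
  qed
  have "\<gamma> \<otimes> d = c \<otimes> v \<ominus> (\<one> \<oplus> c \<otimes> v)"
    unfolding \<gamma>_def using cl d id bd by (simp add: a_minus_def l_distr l_minus)
  also have "\<dots> = \<ominus> \<one>"
    using cl v(1) a_lcomm[of "c \<otimes> v" "\<ominus> \<one>" "\<ominus> (c \<otimes> v)"] by (simp add: a_minus_def minus_add r_neg)
  finally have "\<gamma> \<otimes> (\<ominus> d) = \<one>" using d by (simp add: r_minus)
  then have "\<delta> = \<ominus> d"
    unfolding \<delta> \<gamma>_def[symmetric] using d by (intro comm_inv_char) auto
  then have "frob_sum (\<delta> \<oplus> d) (n * p) = \<zero>"
    using d frob_sum_low[OF low_zero] by (simp add: l_neg)
  then have "frob_sum d (n * p) = \<zero>"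
    using d contr by (simp add: frob_sum_add)
  \<comment> \<open>The constant \<open>c\<close> has trace zero, as it has degree less than
    \<open>p - 1\<close>, and \<open>c \<otimes> c\<close> comes out of the sum because Frobenius
    fixes it.\<close>
  moreover have "frob_sum d (n * p) = (c \<otimes> c) \<otimes> frob_sum v (n * p)"
    unfolding d_def using frob_sum_low[OF E_low[OF cE]] cl v(1) K(2)[OF c(1)]
    by (simp add: frob_sum_add frob_sum_mult del: One_nat_def)
  ultimately have "(c \<otimes> c) \<otimes> frob_sum \<gamma> (n * p) = \<zero>" using tr_v by simp
  then show False using \<gamma>_trace c(3) cl by (auto dest!: integral)
qed

end

section \<open>Irreducibility of Artin-Schreier polynomials\<close>

lemma (in domain) poly_ring_domain: "domain (poly_ring R)"
  by (rule univ_poly_is_domain[OF carrier_is_subring])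

lemma (in ring_hom_ring) hom_add_pow_nat:
  assumes "x \<in> carrier R" shows "h ([(k::nat)] \<cdot>\<^bsub>R\<^esub> x) = [k] \<cdot>\<^bsub>S\<^esub> h x"
  by (induction k) (use assms in auto)

lemma (in ring_hom_ring) hom_nat_pow:
  assumes "x \<in> carrier R" shows "h (x [^]\<^bsub>R\<^esub> (k::nat)) = h x [^]\<^bsub>S\<^esub> k"
  by (induction k) (use assms in auto)

context domain
begin

lemma artin_schreier_poly_closed:
  assumes "a \<in> carrier R"
  shows "poly_of_const a \<in> carrier (poly_ring R)" "artin_schreier_poly R p a \<in> carrier (poly_ring R)"
proof -
  interpret UP: domain "poly_ring R" by (rule poly_ring_domain)
  show c: "poly_of_const a \<in> carrier (poly_ring R)"
    using ring_hom_memE(1)[OF canonical_embedding_is_hom[OF carrier_is_subring]] assms by simp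
  show "artin_schreier_poly R p a \<in> carrier (poly_ring R)"
    unfolding artin_schreier_poly_def
    using var_closed(1)[OF carrier_is_subring] c by simp
qed

lemma degree_artin_schreier_poly:
  assumes a: "a \<in> carrier R" and p: "1 < p"
  shows "degree (artin_schreier_poly R p a) = p"
proof -
  interpret UP: domain "poly_ring R" by (rule poly_ring_domain)
  note X = var_closed(1)[OF carrier_is_subring]
  note c = artin_schreier_poly_closed(1)[OF a]
  have degX: "degree X = 1" by (simp add: var_def)
  have add: "degree (u \<oplus>\<^bsub>poly_ring R\<^esub> v) = degree u"
    if "u \<in> carrier (poly_ring R)" "v \<in> carrier (poly_ring R)" "degree v < degree u" for u v
    using poly_add_degree_eq[OF carrier_is_subring, of u v] that
    by (simp add: univ_poly_add univ_poly_carrier)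
  have minus: "degree (u \<ominus>\<^bsub>poly_ring R\<^esub> v) = degree u"
    if "u \<in> carrier (poly_ring R)" "v \<in> carrier (poly_ring R)" "degree v < degree u" for u v
    unfolding a_minus_def using add[of u "\<ominus>\<^bsub>poly_ring R\<^esub> v"] that
      univ_poly_a_inv_degree[OF carrier_is_subring that(2)] by simp
  have Xp: "X [^]\<^bsub>poly_ring R\<^esub> p \<in> carrier (poly_ring R)" using X by simp
  have degXp: "degree (X [^]\<^bsub>poly_ring R\<^esub> p) = p"
    using polynomial_pow_degree[OF X, of p] degX by simp
  have degc: "degree (poly_of_const a) = 0"
    by (simp add: poly_of_const_def)
  have 1: "degree (X [^]\<^bsub>poly_ring R\<^esub> p \<ominus>\<^bsub>poly_ring R\<^esub> X) = p"
    using minus[OF Xp X] degX degXp p by simp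
  show ?thesis
    unfolding artin_schreier_poly_def
    using minus[OF UP.minus_closed[OF Xp X] c] 1 degc p by simp
qed

text \<open>For \<open>h\<close> a residue map, the class of the indeterminate is thus a root. This
  serves both for the quotient by the polynomial itself and for the quotient by one of its
  factors.\<close>

lemma artin_schreier_hom_root:
  assumes "ring_hom_ring (poly_ring R) S h" and a: "a \<in> carrier R"
    and "h (artin_schreier_poly R p a) = \<zero>\<^bsub>S\<^esub>"
  shows "h X [^]\<^bsub>S\<^esub> p = h X \<oplus>\<^bsub>S\<^esub> h (poly_of_const a)"
proof -
  interpret h: ring_hom_ring "poly_ring R" S h by fact
  note X = var_closed(1)[OF carrier_is_subring]
  note c = artin_schreier_poly_closed(1)[OF a]
  have hX: "h X \<in> carrier S" "h (poly_of_const a) \<in> carrier S" using X c by auto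
  have "h X [^]\<^bsub>S\<^esub> p \<ominus>\<^bsub>S\<^esub> h X \<ominus>\<^bsub>S\<^esub> h (poly_of_const a) = \<zero>\<^bsub>S\<^esub>"
    using assms(3) X c unfolding artin_schreier_poly_def
    by (simp add: a_minus_def h.hom_nat_pow)
  then have "h X [^]\<^bsub>S\<^esub> p \<ominus>\<^bsub>S\<^esub> h X = h (poly_of_const a)"
    using hX by (metis h.S.r_right_minus_eq h.S.minus_closed h.S.nat_pow_closed)
  moreover have "h X [^]\<^bsub>S\<^esub> p = (h X [^]\<^bsub>S\<^esub> p \<ominus>\<^bsub>S\<^esub> h X) \<oplus>\<^bsub>S\<^esub> h X"
    using hX by (simp add: a_minus_def h.S.a_assoc h.S.l_neg)
  ultimately show ?thesis using hX by (simp add: h.S.a_comm)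
qed

end

context field
begin

lemma rupture_surj_self:
  assumes "g \<in> carrier (poly_ring R)"
  shows "rupture_surj (carrier R) g g = \<zero>\<^bsub>Rupt (carrier R) g\<^esub>"
proof -
  interpret UP: cring "poly_ring R" by (rule univ_poly_is_cring[OF carrier_is_subring])
  show ?thesis
    unfolding rupture_def FactRing_def
    using UP.a_rcos_zero[OF UP.cgenideal_ideal[OF assms] UP.cgenideal_self[OF assms]] by simp
qed

lemma rupture_embedding:
  assumes g: "g \<in> carrier (poly_ring R)" "pirreducible (carrier R) g"
  defines "S \<equiv> Rupt (carrier R) g" and "h \<equiv> rupture_surj (carrier R) g \<circ> poly_of_const"
  shows "field S" "ring_hom_ring R S h" "inj_on h (carrier R)" "subfield (h ` carrier R) S"
    "ring.dimension S (degree g) (h ` carrier R) (carrier S)"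
proof -
  show S: "field S"
    unfolding S_def using rupture_is_field_iff_pirreducible[OF carrier_is_subfield g(1)] g(2) by simp
  interpret S: field S by fact
  show h: "ring_hom_ring R S h"
    using rupture_surj_norm_is_hom[OF carrier_is_subring g(1)] unfolding h_def S_def
    by (intro ring_hom_ringI2[OF ring_axioms S.ring_axioms[unfolded S_def]]) simp
  interpret h: ring_hom_ring R S h by fact
  show "inj_on h (carrier R)" "subfield (h ` carrier R) S"
    using h.img_is_subfield[OF carrier_is_subfield S.one_not_zero] by auto
  have "degree g > 0"
    using pirreducible_degree[OF carrier_is_subfield g] by simp
  from rupture_dimension[OF carrier_is_subfield g(1) this]
  show "ring.dimension S (degree g) (h ` carrier R) (carrier S)"
    unfolding S_def h_def by (simp add: image_comp)
qed

end

lemma (in char_field) rupture_char_field: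
  assumes "g \<in> carrier (poly_ring R)" "pirreducible (carrier R) g"
  shows "char_field (Rupt (carrier R) g) p"
proof -
  let ?h = "rupture_surj (carrier R) g \<circ> poly_of_const"
  interpret S: field "Rupt (carrier R) g" by (rule rupture_embedding[OF assms])
  interpret h: ring_hom_ring R "Rupt (carrier R) g" ?h by (rule rupture_embedding[OF assms])
  have "[p] \<cdot>\<^bsub>Rupt (carrier R) g\<^esub> \<one>\<^bsub>Rupt (carrier R) g\<^esub> = ?h ([p] \<cdot> \<one>)"
    using h.hom_add_pow_nat[OF one_closed, of p] h.hom_one by (simp del: comp_apply)
  then show ?thesis
    using prime char h.hom_zero by unfold_locales (simp_all del: comp_apply)
qed

text \<open>The conjugates repeat with period \<open>N\<close>. The case in use is the trace of an
  element of the base field in an extension of degree \<open>k\<close>.\<close>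

lemma (in char_field) frob_sum_mult_period:
  assumes "x \<in> carrier R" "frob N x = x"
  shows "frob_sum x (N * k) = [k] \<cdot> frob_sum x N"
proof -
  have split: "frob_sum x (i + j) = frob_sum x i \<oplus> frob_sum (frob i x) j" for i j
    by (induction j) (use assms(1) in \<open>simp_all add: a_assoc frob_frob add.commute\<close>)
  show ?thesis
  proof (induction k)
    case (Suc k)
    have "frob_sum x (N * Suc k) = frob_sum x N \<oplus> frob_sum x (N * k)"
      using split[of N "N * k"] assms(2) by simp
    then show ?case using Suc assms(1) by (simp add: a_comm)
  qed simp
qed

lemma (in char_field) irreducible_artin_schreier_poly:
  assumes card: "card (carrier R) = p ^ N" and a: "a \<in> carrier R" and tr: "frob_sum a N \<noteq> \<zero>"
  shows "pirreducible (carrier R) (artin_schreier_poly R p a)" (is "pirreducible _ ?f")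
proof -
  interpret UP: principal_domain "poly_ring R"
    by (rule univ_poly_is_principal[OF carrier_is_subfield])
  have p1: "1 < p" using p_gt_1 by simp
  note f = artin_schreier_poly_closed(2)[OF a, of p]
  note deg = degree_artin_schreier_poly[OF a p1]
  have fin: "finite (carrier R)" using card p_pos by (metis card.infinite less_irrefl zero_less_power)
  have units: "q \<in> Units (poly_ring R) \<longleftrightarrow> q \<in> carrier (poly_ring R) \<and> q \<noteq> [] \<and> degree q = 0" for q
    by (rule univ_poly_units'[OF carrier_is_subfield])
  show ?thesis
  proof (rule pirreducibleI[OF carrier_is_subring f])
    show "?f \<noteq> []" using deg p1 by auto
    show "?f \<notin> Units (poly_ring R)" unfolding units deg using p1 by simp
    fix q r assume qr: "q \<in> carrier (poly_ring R)" "r \<in> carrier (poly_ring R)" "?f = q \<otimes>\<^bsub>poly_ring R\<^esub> r"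
    show "q \<in> Units (poly_ring R) \<or> r \<in> Units (poly_ring R)"
    proof (rule ccontr)
      assume non: "\<not> ?thesis"
      have nz: "q \<noteq> []" "r \<noteq> []"
        using qr \<open>?f \<noteq> []\<close> UP.l_null UP.r_null by (auto simp: univ_poly_zero)
      have "degree q + degree r = p"
        using poly_mult_degree_eq[OF carrier_is_subring, of q r] qr nz deg
        by (simp add: univ_poly_carrier univ_poly_mult)
      moreover have "0 < degree r" using non qr nz units by auto
      ultimately have q_lt: "degree q < p" by linarith
      \<comment> \<open>\<open>g\<close> is an irreducible factor of \<open>?f\<close> of degree
        strictly between 0 and \<open>p\<close>; adjoining a root of it will give
        \<open>S\<close>.\<close>
      obtain g where g: "g \<in> carrier (poly_ring R)" "pirreducible (carrier R) g" "g divides\<^bsub>poly_ring R\<^esub> q"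
      proof (rule UP.exists_irreducible_divisor)
        show "q \<in> carrier (poly_ring R) - {\<zero>\<^bsub>poly_ring R\<^esub>}" using qr(1) nz(1) by (simp add: univ_poly_zero)
        show "q \<notin> Units (poly_ring R)" using non by blast
      qed
      have "degree g \<le> degree q"
        using pdivides_imp_degree_le[OF carrier_is_subring g(1) qr(1) nz(1)] g(3) by (simp add: pdivides_def)
      then have d: "0 < degree g" "degree g < p"
        using q_lt pirreducible_degree[OF carrier_is_subfield g(1,2)] by auto
      define S where "S = Rupt (carrier R) g"
      define h where "h = rupture_surj (carrier R) g \<circ> poly_of_const"
      note emb = rupture_embedding[OF g(1,2), folded S_def h_def]
      interpret S: char_field S p unfolding S_def by (rule rupture_char_field[OF g(1,2)])
      interpret h: ring_hom_ring R S h by (rule emb(2))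
      interpret s: ring_hom_ring "poly_ring R" S "rupture_surj (carrier R) g"
        unfolding S_def by (rule rupture_surj_hom(2)[OF carrier_is_subring g(1)])
      have "rupture_surj (carrier R) g g = \<zero>\<^bsub>S\<^esub>"
        unfolding S_def by (rule rupture_surj_self[OF g(1)])
      moreover obtain k where k: "k \<in> carrier (poly_ring R)" "q = g \<otimes>\<^bsub>poly_ring R\<^esub> k"
        using g(3) by (auto simp: factor_def)
      ultimately have "rupture_surj (carrier R) g ?f = \<zero>\<^bsub>S\<^esub>"
        unfolding qr(3) k(2) using g(1) k(1) qr(2) by simp
      define y where "y = rupture_surj (carrier R) g X"
      have y: "y \<in> carrier S" unfolding y_def using var_closed(1)[OF carrier_is_subring] by simp
      have ha: "h a \<in> carrier S" using a by simp
      have root: "y [^]\<^bsub>S\<^esub> p = y \<oplus>\<^bsub>S\<^esub> h a"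
        unfolding y_def h_def comp_apply
        by (rule artin_schreier_hom_root[OF s.ring_hom_ring_axioms a]) fact
      have "card (carrier S) = card (h ` carrier R) ^ degree g"
        using S.dimension_card[OF emb(5,4)] fin by simp
      also have "card (h ` carrier R) = p ^ N" using card_image[OF emb(3)] card by simp
      finally have cardS: "card (carrier S) = p ^ (N * degree g)" by (simp add: power_mult)
      then have "finite (carrier S)" using p_pos by (metis card.infinite less_irrefl zero_less_power)
      \<comment> \<open>The size of \<open>S\<close> makes this power of Frobenius fix the root
        \<open>y\<close>, while \<open>frob_artin_schreier\<close> makes it add the conjugate sum of
        \<open>h a\<close>. That sum is therefore zero.\<close>
      then have "S.frob (N * degree g) y = y"
        using S.subfield_pow_card[OF S.carrier_is_subfield _ y] cardS by (simp add: S.frob_def)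
      then have "y \<oplus>\<^bsub>S\<^esub> S.frob_sum (h a) (N * degree g) = y \<oplus>\<^bsub>S\<^esub> \<zero>\<^bsub>S\<^esub>"
        using S.frob_artin_schreier[OF y ha root, of "N * degree g"] y by simp
      then have "S.frob_sum (h a) (N * degree g) = \<zero>\<^bsub>S\<^esub>" using y ha by simp
      moreover have "h (frob_sum a i) = S.frob_sum (h a) i" for i
        by (induction i) (use a in \<open>simp_all add: frob_def S.frob_def h.hom_nat_pow\<close>)
      ultimately have "h (frob_sum a (N * degree g)) = h \<zero>" by simp
      then have "frob_sum a (N * degree g) = \<zero>"
        by (rule inj_onD[OF emb(3)]) (use a in auto)
      moreover have "frob N a = a"
        using subfield_pow_card[OF carrier_is_subfield fin a] card by (simp add: frob_def)
      \<comment> \<open>The sum runs \<open>degree g\<close> times through the trace of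
        \<open>a\<close>, which is nonzero, so \<open>p\<close> divides
        \<open>degree g\<close>.\<close>
      ultimately have "[degree g] \<cdot> frob_sum a N = \<zero>"
        using frob_sum_mult_period[OF a, of N "degree g"] by simp
      then have "p dvd degree g" using add_pow_eq_zero_iff[OF _ tr] a by simp
      then show False using d dvd_imp_le by fastforce
    qed
  qed
qed

section \<open>The normal basis\<close>

lemma (in ring_hom_ring) hom_field_inv:
  assumes "field R" "field S" "x \<in> carrier R" "x \<noteq> \<zero>\<^bsub>R\<^esub>"
  shows "h (inv\<^bsub>R\<^esub> x) = inv\<^bsub>S\<^esub> (h x)"
proof -
  interpret R: field R by fact
  interpret S: field S by fact
  have i: "inv\<^bsub>R\<^esub> x \<in> carrier R" "x \<otimes>\<^bsub>R\<^esub> inv\<^bsub>R\<^esub> x = \<one>\<^bsub>R\<^esub>"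
    using assms(3,4) R.field_Units by (auto intro: R.Units_inv_closed R.Units_r_inv)
  then have "h x \<otimes>\<^bsub>S\<^esub> h (inv\<^bsub>R\<^esub> x) = \<one>\<^bsub>S\<^esub>"
    using assms(3) by (metis hom_mult hom_one)
  then show ?thesis using i assms(3) by (intro S.comm_inv_char[symmetric]) auto
qed

lemma prime_field_extension:
  assumes "prime p" "field F" "\<iota> \<in> ring_hom (residue_ring (int p)) F"
  shows "ring_hom_ring (residue_ring (int p)) F \<iota>" "inj_on \<iota> (carrier (residue_ring (int p)))"
    "subfield (\<iota> ` carrier (residue_ring (int p))) F"
    "card (\<iota> ` carrier (residue_ring (int p))) = p" "char_field F p"
proof -
  let ?Z = "residue_ring (int p)"
  interpret F: field F by fact
  interpret Z: residues_prime p ?Z using assms(1) by unfold_locales simp_all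
  interpret Z: field ?Z by (rule Z.is_field)
  show hom: "ring_hom_ring ?Z F \<iota>" by (rule ring_hom_ringI2[OF Z.ring_axioms F.ring_axioms assms(3)])
  interpret h: ring_hom_ring ?Z F \<iota> by fact
  show inj: "inj_on \<iota> (carrier ?Z)" and "subfield (\<iota> ` carrier ?Z) F"
    using h.img_is_subfield[OF Z.carrier_is_subfield] by auto
  show "card (\<iota> ` carrier ?Z) = p"
    using card_image[OF inj] by (simp add: Z.res_carrier_eq)
  have mult: "[k] \<cdot>\<^bsub>?Z\<^esub> \<one>\<^bsub>?Z\<^esub> = int k mod int p" for k
    by (induction k) (simp_all add: Z.res_zero_eq Z.res_one_eq Z.res_add_eq mod_simps add.commute)
  have "[p] \<cdot>\<^bsub>?Z\<^esub> \<one>\<^bsub>?Z\<^esub> = \<zero>\<^bsub>?Z\<^esub>" unfolding mult by (simp add: Z.res_zero_eq)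
  then have "[p] \<cdot>\<^bsub>F\<^esub> \<one>\<^bsub>F\<^esub> = \<zero>\<^bsub>F\<^esub>"
    using h.hom_add_pow_nat[OF Z.one_closed, of p] h.hom_zero h.hom_one by simp
  then show "char_field F p" using assms(1) by unfold_locales
qed

lemma (in field) rupture_low_eq_carrier:
  assumes g: "g \<in> carrier (poly_ring R)" "pirreducible (carrier R) g"
  shows "power_span.low (Rupt (carrier R) g) ((rupture_surj (carrier R) g \<circ> poly_of_const) ` carrier R)
    (rupture_surj (carrier R) g X) (degree g) = carrier (Rupt (carrier R) g)"
proof -
  define S where "S = Rupt (carrier R) g"
  define h where "h = rupture_surj (carrier R) g \<circ> poly_of_const"
  define y where "y = rupture_surj (carrier R) g X"
  note emb = rupture_embedding[OF g, folded S_def h_def]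
  interpret UP: domain "poly_ring R" by (rule poly_ring_domain)
  interpret S: field S by (rule emb(1))
  interpret s: ring_hom_ring "poly_ring R" S "rupture_surj (carrier R) g"
    unfolding S_def by (rule rupture_surj_hom(2)[OF carrier_is_subring g(1)])
  have y: "y \<in> carrier S" unfolding y_def using var_closed(1)[OF carrier_is_subring] by simp
  interpret P: power_span S "h ` carrier R" y
    by (intro power_span.intro power_span_axioms.intro S.domain_axioms emb(4) y)
  have g0: "g \<noteq> []" using pirreducible_degree[OF carrier_is_subfield g] by auto
  have "x \<in> P.low (degree g)" if "x \<in> carrier S" for x
  proof -
    have "x \<in> rupture_surj (carrier R) g ` (\<lambda>q. q pmod g) ` carrier (poly_ring R)"
      using that unfolding S_def rupture_carrier_as_pmod_image[OF carrier_is_subfield g(1)] .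
    then obtain q where q: "q \<in> carrier (poly_ring R)" "x = rupture_surj (carrier R) g (q pmod g)"
      by (elim imageE) simp
    define r where "r = q pmod g"
    have r: "r \<in> carrier (poly_ring R)"
      unfolding r_def by (rule long_division_closed(2)[OF carrier_is_subfield q(1) g(1)])
    \<comment> \<open>For a nonzero polynomial \<open>length\<close> exceeds the degree by one, so a
      remainder of smaller degree has a coefficient list of length at most
      \<open>degree g\<close>.\<close>
    have len: "length r \<le> degree g"
      using pmod_degree[OF carrier_is_subfield q(1) g(1) g0] unfolding r_def by auto
    \<comment> \<open>A polynomial is its own value at the indeterminate; applying the residue map
      turns this into an expression in \<open>y\<close>.\<close>
    have "x = rupture_surj (carrier R) g (UP.eval (map poly_of_const r) X)"
      unfolding q(2) r_def[symmetric] using eval_rewrite[OF carrier_is_subring r] by simp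
    also have "\<dots> = S.eval (map h r) y"
      using s.eval_hom[OF UP.carrier_is_subring var_closed(1)[OF carrier_is_subring]
          map_norm_in_poly_ring_carrier[OF carrier_is_subring r]]
      unfolding h_def y_def by simp
    also have "\<dots> \<in> P.low (length r)"
      using P.eval_low[of "map h r"] r
      by (auto simp: univ_poly_carrier[symmetric] polynomial_def simp del: comp_apply)
    finally show ?thesis using P.low_mono[OF len] by blast
  qed
  then show ?thesis unfolding S_def[symmetric] h_def[symmetric] y_def[symmetric] using P.low_closed by blast
qed

theorem theorem2p3:
  fixes F :: "('a, 'b) ring_scheme"
    and p m n :: nat
    and \<iota> :: "int \<Rightarrow> 'a"
    and \<alpha> :: 'a
    and b :: int
    and Fhat :: "('a list set) ring"
    and j :: "'a \<Rightarrow> 'a list set"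
    and \<beta> \<delta> :: "'a list set"
  assumes "prime p"
    and "field F"
    and "\<iota> \<in> ring_hom (residue_ring (int p)) F"
    and "ring.dimension F n (\<iota> ` carrier (residue_ring (int p))) (carrier F)"
    and "m > 0" and "n = m * p"
    and "\<alpha> \<in> carrier F - {\<zero>\<^bsub>F\<^esub>}"
    and "pirreducible\<^bsub>F\<^esub> (carrier F) (artin_schreier_poly F p \<alpha>)"
    and "basis_over F (\<iota> ` carrier (residue_ring (int p))) (inv_frobenius_list F p \<alpha> n)"
    and "Fhat = artin_schreier_ext F p \<alpha>"
    and "j = artin_schreier_embed F p \<alpha>"
    and "\<beta> = artin_schreier_root F p \<alpha>"
    and "b \<in> carrier (residue_ring (int p)) - {\<zero>\<^bsub>residue_ring (int p)\<^esub>}"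
    and "\<delta> = inv\<^bsub>Fhat\<^esub> (inv\<^bsub>Fhat\<^esub> \<beta> \<ominus>\<^bsub>Fhat\<^esub> j (\<iota> b))"
  shows "pirreducible\<^bsub>Fhat\<^esub> (carrier Fhat) (artin_schreier_poly Fhat p \<delta>) \<and>
         basis_over Fhat ((j \<circ> \<iota>) ` carrier (residue_ring (int p)))
           (inv_frobenius_list Fhat p \<delta> (n * p))"
proof -
  let ?Z = "residue_ring (int p)"
  let ?f = "artin_schreier_poly F p \<alpha>"
  define K0 where "K0 = \<iota> ` carrier ?Z"
  define K where "K = (j \<circ> \<iota>) ` carrier ?Z"
  note pf = prime_field_extension[OF assms(1-3), folded K0_def]
  interpret F: char_field F p by (rule pf(5))
  have \<alpha>: "\<alpha> \<in> carrier F" "\<alpha> \<noteq> \<zero>\<^bsub>F\<^esub>" using assms(7) by auto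
  have p1: "1 < p" using F.p_gt_1 by simp
  note f = F.artin_schreier_poly_closed(2)[OF \<alpha>(1), of p]
  note deg = F.degree_artin_schreier_poly[OF \<alpha>(1) p1]
  have Fhat: "Fhat = Rupt\<^bsub>F\<^esub> (carrier F) ?f" using assms(10) by (simp add: artin_schreier_ext_def)
  have j: "j = F.rupture_surj (carrier F) ?f \<circ> F.poly_of_const"
    unfolding assms(11) by (simp add: artin_schreier_embed_def fun_eq_iff)
  have \<beta>: "\<beta> = F.rupture_surj (carrier F) ?f X\<^bsub>F\<^esub>"
    unfolding assms(12) by (simp add: artin_schreier_root_def)
  note emb = F.rupture_embedding[OF f assms(8), folded Fhat j, unfolded deg]
  interpret L: char_field Fhat p unfolding Fhat by (rule F.rupture_char_field[OF f assms(8)])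
  interpret h: ring_hom_ring F Fhat j by (rule emb(2))
  interpret s: ring_hom_ring "poly_ring F" Fhat "F.rupture_surj (carrier F) ?f"
    unfolding Fhat by (rule F.rupture_surj_hom(2)[OF F.carrier_is_subring f])
  interpret UP: domain "poly_ring F" by (rule F.poly_ring_domain)
  have \<beta>_cl: "\<beta> \<in> carrier Fhat"
    unfolding \<beta> using F.var_closed(1)[OF F.carrier_is_subring] by simp
  have "F.rupture_surj (carrier F) ?f ?f = \<zero>\<^bsub>Fhat\<^esub>"
    unfolding Fhat by (rule F.rupture_surj_self[OF f])
  from F.artin_schreier_hom_root[OF s.ring_hom_ring_axioms \<alpha>(1) this]
  have root: "\<beta> [^]\<^bsub>Fhat\<^esub> p = \<beta> \<oplus>\<^bsub>Fhat\<^esub> j \<alpha>" unfolding \<beta> j by simp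
  have dimF: "F.dimension n K0 (carrier F)" using assms(4) unfolding K0_def .
  have finK0: "finite K0" by (rule card_ge_0_finite) (use pf(4) p1 in simp)
  have cardF: "card (carrier F) = p ^ n" "finite (carrier F)"
    using F.dimension_card[OF dimF pf(3) finK0] pf(4) by auto
  have cardE: "card (j ` carrier F) = p ^ n" using card_image[OF emb(3)] cardF by simp
  have cardL: "card (carrier Fhat) = p ^ (n * p)"
    using L.dimension_card[OF emb(5,4)] cardF(2) cardE by (simp add: power_mult)
  have K_image: "K = j ` K0" unfolding K_def K0_def by (simp add: image_comp)
  have K0_sub: "K0 \<subseteq> carrier F" using subringE(1)[OF subfieldE(1)[OF pf(3)]] .
  have K_sub: "subfield K Fhat"
    unfolding K_image by (rule h.img_is_subfield(2)[OF pf(3) L.one_not_zero])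
  have cardK: "card K = p"
    unfolding K_image using card_image[OF inj_on_subset[OF emb(3) K0_sub]] pf(4) by simp
  have finK: "finite K" by (rule card_ge_0_finite) (use cardK p1 in simp)
  \<comment> \<open>Fermat's little theorem, as \<open>K\<close> has \<open>p\<close>
    elements.\<close>
  have K_fixed: "L.frob 1 k = k" if "k \<in> K" for k
    using L.subfield_pow_card[OF K_sub finK that] cardK by (simp add: L.frob_def)
  have dimE: "L.dimension n K (j ` carrier F)"
    unfolding K_image by (rule h.inj_hom_dimension[OF pf(3) L.one_not_zero emb(3) dimF])
  \<comment> \<open>Tower law: degree \<open>n\<close> from \<open>K\<close> to the image of
    \<open>F\<close>, and degree \<open>p\<close> from there to \<open>Fhat\<close>.\<close>
  have dimL: "L.dimension (n * p) K (carrier Fhat)"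
    by (rule L.telescopic_base[OF K_sub emb(4) dimE emb(5)])
  have j\<alpha>: "j \<alpha> \<noteq> \<zero>\<^bsub>Fhat\<^esub>"
    using inj_onD[OF emb(3), of \<alpha> "\<zero>\<^bsub>F\<^esub>"] \<alpha> h.hom_zero by auto
  have SpanF: "F.Span K0 (inv_frobenius_list F p \<alpha> n) = carrier F"
    using assms(9) by (simp add: basis_over_def K0_def del: F.Span.simps)
  have i\<alpha>: "inv\<^bsub>F\<^esub> \<alpha> \<in> carrier F" using \<alpha> F.field_Units by (simp add: F.Units_inv_closed)
  \<comment> \<open>\<open>j\<close> carries the conjugates of 1/\<alpha> to those of 1/j(\<alpha>),
    and spans over \<open>K0\<close> to spans over \<open>K\<close>.\<close>
  have conj: "map j (inv_frobenius_list F p \<alpha> n) = map (\<lambda>i. L.frob i (inv\<^bsub>Fhat\<^esub> (j \<alpha>))) [0..<n]"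
    using i\<alpha> h.hom_field_inv[OF assms(2) emb(1) \<alpha>]
    by (simp add: inv_frobenius_list_def L.frob_def h.hom_nat_pow)
  have "set (inv_frobenius_list F p \<alpha> n) \<subseteq> carrier F"
    using i\<alpha> by (auto simp: inv_frobenius_list_def)
  from h.Span_hom[OF K0_sub this]
  have Span_E: "L.Span K (map (\<lambda>i. L.frob i (inv\<^bsub>Fhat\<^esub> (j \<alpha>))) [0..<n]) = j ` carrier F"
    unfolding conj SpanF K_image .
  have b: "b \<in> carrier ?Z" "b \<noteq> \<zero>\<^bsub>?Z\<^esub>" using assms(13) by auto
  interpret Z: ring_hom_ring ?Z F \<iota> by (rule pf(1))
  have \<iota>b: "\<iota> b \<in> K0" "\<iota> b \<noteq> \<zero>\<^bsub>F\<^esub>"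
    using b inj_onD[OF pf(2), of b "\<zero>\<^bsub>?Z\<^esub>"] Z.hom_zero by (auto simp: K0_def)
  have jb: "j (\<iota> b) \<in> K" "j (\<iota> b) \<noteq> \<zero>\<^bsub>Fhat\<^esub>"
    using \<iota>b K0_sub inj_onD[OF emb(3), of "\<iota> b" "\<zero>\<^bsub>F\<^esub>"] h.hom_zero by (auto simp: K_image)
  interpret P: power_span Fhat "j ` carrier F" \<beta>
    by (intro power_span.intro power_span_axioms.intro L.domain_axioms emb(4) \<beta>_cl)
  have n0: "0 < n" using assms(5,6) p1 by simp
  have j\<alpha>_E: "j \<alpha> \<in> j ` carrier F" using \<alpha>(1) by simp
  have low_p: "P.low p = carrier Fhat"
    using F.rupture_low_eq_carrier[OF f assms(8)] unfolding Fhat[symmetric] j[symmetric] \<beta>[symmetric] deg .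
  have K_E: "K \<subseteq> j ` carrier F" unfolding K_image using K0_sub by blast
  have tower: "artin_schreier_tower Fhat p (j ` carrier F) \<beta> n (j \<alpha>)"
    by (rule artin_schreier_tower.intro[OF L.char_field_axioms P.power_span_axioms
          artin_schreier_tower_axioms.intro[OF n0 cardE cardL j\<alpha>_E root low_p]])
  interpret T: artin_schreier_step Fhat p "j ` carrier F" \<beta> n "j \<alpha>" K "j (\<iota> b)" \<delta>
    by (rule artin_schreier_step.intro[OF tower
          artin_schreier_step_axioms.intro[OF K_sub K_fixed K_E dimL j\<alpha> Span_E jb assms(14)]])
  have "pirreducible\<^bsub>Fhat\<^esub> (carrier Fhat) (artin_schreier_poly Fhat p \<delta>)"
    by (rule L.irreducible_artin_schreier_poly[OF cardL T.\<delta>_closed T.\<delta>_trace])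
  moreover have "basis_over Fhat K (inv_frobenius_list Fhat p \<delta> (n * p))"
    using T.\<delta>_orbit unfolding basis_over_def inv_frobenius_list_def L.frob_def by blast
  ultimately show ?thesis unfolding K_def by blast
qed

end
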